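(* Assume (A2) and (A3), and consider parameter values $(\eta,\sigma^2,b,d)$ for which $\rho<0$, so that the tail-index $\alpha$ (the unique $\alpha>0$ with $h(\alpha)=1$) is defined. Then: the tail-index $\alpha$ is strictly increasing in the batch-size $b$ and strictly decreasing in the stepsize $\eta$ and in the variance $\sigma^2$, provided that $\alpha\ge 1$; moreover, $\alpha$ is strictly decreasing in the dimension $d$.
   Context: Setup: integers $d,b\ge1$, stepsize $\eta>0$, i.i.d. data $(a_i,y_i)$ with $a_i\in\mathbb{R}^d$, $y_i\in\mathbb{R}$; $H_k=\sum_{i=b(k-1)+1}^{bk}a_ia_i^T$, $M_k=I_d-\frac{\eta}{b}H_k$, $q_k=\frac{\eta}{b}\sum_{i=b(k-1)+1}^{bk}a_iy_i$, SGD iterates $x_k=M_kx_{k-1}+q_k$. $\|\cdot\|$ is the Euclidean/spectral norm. $\Pi_k=M_k\cdots M_1$, $h(s)=\lim_{k\to\infty}(\mathbb{E}\|\Pi_k\|^s)^{1/k}$, $\rho=\lim_{k\to\infty}(2k)^{-1}\log\lambda_{\max}(\Pi_k^T\Pi_k)$. Assumptions: (A2) $y_i$ i.i.d. with continuous density supported on $\mathbb{R}$, all moments finite. (A3) $a_i\sim\mathcal{N}(0,\sigma^2I_d)$ i.i.d. Under these assumptions and $\rho<0$ there is a unique $\alpha>0$ with $h(\alpha)=1$, called the tail-index. *)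

theory Defs
  imports "HOL-Probability.Probability" "Jordan_Normal_Form.Char_Poly"
begin

text \<open>Parameters: stepsize eta, variance v (= sigma^2), batch size b, dimension d.
  All data are realised on one canonical probability space: a sample
  omega :: nat \<times> nat \<Rightarrow> real, where omega (i, j) is the j-th coordinate
  (j < d) of the data vector a_i (i \<ge> 1). All coordinates are i.i.d.
  N(0, v), i.e. a_i ~ N(0, v I_d) i.i.d.  The responses y_i do not enter
  h, rho or the tail-index, so they are not modelled.\<close>

definition data_space :: "real \<Rightarrow> (nat \<times> nat \<Rightarrow> real) measure" where
  "data_space v = PiM UNIV (\<lambda>_. density lborel (normal_density 0 (sqrt v)))"

definition avec :: "nat \<Rightarrow> (nat \<times> nat \<Rightarrow> real) \<Rightarrow> nat \<Rightarrow> real vec" where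
  "avec d \<omega> i = vec d (\<lambda>j. \<omega> (i, j))"

definition Hmat :: "nat \<Rightarrow> nat \<Rightarrow> (nat \<times> nat \<Rightarrow> real) \<Rightarrow> nat \<Rightarrow> real mat" where
  "Hmat b d \<omega> k = mat d d (\<lambda>(p, q). \<Sum>i\<in>{b * (k - 1) + 1 .. b * k}.
      (avec d \<omega> i) $ p * (avec d \<omega> i) $ q)"

definition Mmat :: "real \<Rightarrow> nat \<Rightarrow> nat \<Rightarrow> (nat \<times> nat \<Rightarrow> real) \<Rightarrow> nat \<Rightarrow> real mat" where
  "Mmat \<eta> b d \<omega> k = 1\<^sub>m d - (\<eta> / real b) \<cdot>\<^sub>m Hmat b d \<omega> k"

fun Pimat :: "real \<Rightarrow> nat \<Rightarrow> nat \<Rightarrow> (nat \<times> nat \<Rightarrow> real) \<Rightarrow> nat \<Rightarrow> real mat" where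
  "Pimat \<eta> b d \<omega> 0 = 1\<^sub>m d"
| "Pimat \<eta> b d \<omega> (Suc k) = Mmat \<eta> b d \<omega> (Suc k) * Pimat \<eta> b d \<omega> k"

definition vnorm :: "real vec \<Rightarrow> real" where
  "vnorm x = sqrt (scalar_prod x x)"

definition spec_norm :: "nat \<Rightarrow> real mat \<Rightarrow> real" where
  "spec_norm d A = Sup {vnorm (A *\<^sub>v x) | x. x \<in> carrier_vec d \<and> vnorm x = 1}"

definition lambda_max :: "real mat \<Rightarrow> real" where
  "lambda_max A = Max {l. eigenvalue A l}"

definition hfun :: "real \<Rightarrow> real \<Rightarrow> nat \<Rightarrow> nat \<Rightarrow> real \<Rightarrow> real" where
  "hfun \<eta> v b d s = lim (\<lambda>k. (\<integral>\<omega>. spec_norm d (Pimat \<eta> b d \<omega> k) powr s \<partial>data_space v)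
      powr (1 / real k))"

definition rho :: "real \<Rightarrow> real \<Rightarrow> nat \<Rightarrow> nat \<Rightarrow> real" where
  "rho \<eta> v b d = (THE r. AE \<omega> in data_space v.
      (\<lambda>k. ln (lambda_max (transpose_mat (Pimat \<eta> b d \<omega> k) * Pimat \<eta> b d \<omega> k))
         / (2 * real k)) \<longlonglongrightarrow> r)"

definition admissible :: "real \<Rightarrow> real \<Rightarrow> nat \<Rightarrow> nat \<Rightarrow> bool" where
  "admissible \<eta> v b d \<longleftrightarrow> \<eta> > 0 \<and> v > 0 \<and> b \<ge> 1 \<and> d \<ge> 1 \<and> rho \<eta> v b d < 0"

definition tail_index :: "real \<Rightarrow> real \<Rightarrow> nat \<Rightarrow> nat \<Rightarrow> real" where
  "tail_index \<eta> v b d = (THE \<alpha>. \<alpha> > 0 \<and> hfun \<eta> v b d \<alpha> = 1)"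

end

theory Submission
  imports Defs
begin

text \<open>By rotation invariance of the Gaussian law and independence of the batches,
  E |Pi_k u|^s = g(s)^k for every unit vector u, where g(s) = E |M_1 e_1|^s. The spectral norm of Pi_k lies
  between |Pi_k e_1| and the sum of the |Pi_k e_j|, so its s-th moment is g(s)^k up to a constant. This gives
  h(s) = g(s), and Markov's inequality for small positive and negative s together with the Borel-Cantelli
  lemma gives rho = E log |M_1 e_1|. As a moment generating function, g is strictly convex with g(0) = 1 and
  slope rho at 0, so for rho < 0 the tail-index is the point where g crosses 1 from below; hence it suffices
  to compare the functions g for different parameters. Enlarging d adds squares to |M_1 e_1|^2. For s \<ge> 1,
  g is convex in eta * sigma^2 with value 1 at 0, and averaging leave-one-out batches (Jensen's inequality)
  shows that g decreases in b. Strictness is free: the integrands are continuous and the Gaussian product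
  measure has full support, so a single sample with strict inequality suffices.\<close>

section \<open>Infinite product measures\<close>

lemma measure_eqI_nn_integral:
  assumes sets: "sets M = sets N"
    and nn_integral: "\<And>f. f \<in> borel_measurable N \<Longrightarrow> (\<integral>\<^sup>+x. f x \<partial>M) = (\<integral>\<^sup>+x. f x \<partial>N)"
  shows "M = N"
proof (rule measure_eqI[OF sets])
  fix A assume "A \<in> sets M"
  then show "emeasure M A = emeasure N A"
    using nn_integral[of "indicator A"] sets by simp
qed

context product_prob_space
begin

lemma measurable_merge_PiM:
  assumes "J \<subseteq> I"
  shows "merge J (I - J) \<in> PiM I M \<Otimes>\<^sub>M PiM I M \<rightarrow>\<^sub>M PiM I M"
proof (rule measurable_PiM_single')
  fix i assume "i \<in> I"
  then show "(\<lambda>w. merge J (I - J) w i) \<in> PiM I M \<Otimes>\<^sub>M PiM I M \<rightarrow>\<^sub>M M i"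
    by (cases "i \<in> J") (simp_all add: merge_def case_prod_beta')
qed (use assms in \<open>auto simp: space_pair_measure space_PiM PiE_iff merge_def extensional_def\<close>)

lemma distr_merge_PiM:
  assumes J: "J \<subseteq> I"
  shows "distr (PiM I M \<Otimes>\<^sub>M PiM I M) (PiM I M) (merge J (I - J)) = PiM I M"
proof (rule PiM_eq)
  fix K F assume K: "finite K" "K \<subseteq> I" and F: "\<And>j. j \<in> K \<Longrightarrow> F j \<in> sets (M j)"
  let ?box = "\<lambda>L. prod_emb I M L (Pi\<^sub>E L F)"
  have box_sets: "?box L \<in> sets (PiM I M)"
    and emeasure_box: "emeasure (PiM I M) (?box L) = (\<Prod>j\<in>L. emeasure (M j) (F j))"
    if "L \<subseteq> K" for L
    using that K F finite_subset[OF that] by (auto intro!: sets_PiM_I emeasure_PiM_emb)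
  have "merge J (I - J) -` ?box K \<inter> space (PiM I M \<Otimes>\<^sub>M PiM I M) = ?box (K \<inter> J) \<times> ?box (K - J)"
    using J K(2) by (fastforce simp: prod_emb_iff space_pair_measure space_PiM PiE_iff merge_def extensional_def
        split: if_splits)
  then have "emeasure (distr (PiM I M \<Otimes>\<^sub>M PiM I M) (PiM I M) (merge J (I - J))) (?box K)
      = emeasure (PiM I M) (?box (K \<inter> J)) * emeasure (PiM I M) (?box (K - J))"
    using box_sets by (subst emeasure_distr[OF measurable_merge_PiM[OF J]])
      (auto simp: emeasure_pair_measure_Times)
  also have "\<dots> = (\<Prod>j\<in>K. emeasure (M j) (F j))"
    using K(1) by (simp add: emeasure_box prod.Int_Diff[of K _ J])
  finally show "emeasure (distr (PiM I M \<Otimes>\<^sub>M PiM I M) (PiM I M) (merge J (I - J))) (?box K)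
      = (\<Prod>j\<in>K. emeasure (M j) (F j))" .
qed simp

lemma nn_integral_PiM_merge:
  assumes f: "f \<in> borel_measurable (PiM I M)" and J: "J \<subseteq> I"
  shows "(\<integral>\<^sup>+w. f w \<partial>PiM I M) = (\<integral>\<^sup>+w. \<integral>\<^sup>+w'. f (merge J (I - J) (w, w')) \<partial>PiM I M \<partial>PiM I M)"
proof -
  note merge = measurable_merge_PiM[OF J]
  have "(\<integral>\<^sup>+w. f w \<partial>PiM I M) = (\<integral>\<^sup>+z. f (merge J (I - J) z) \<partial>(PiM I M \<Otimes>\<^sub>M PiM I M))"
    using f by (subst distr_merge_PiM[OF J, symmetric], subst nn_integral_distr[OF merge]) simp_all
  also have "\<dots> = (\<integral>\<^sup>+w. \<integral>\<^sup>+w'. f (merge J (I - J) (w, w')) \<partial>PiM I M \<partial>PiM I M)"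
    by (rule nn_integral_fst[symmetric]) (rule measurable_compose[OF merge f])
  finally show ?thesis .
qed

lemma nn_integral_PiM_component:
  assumes f: "f \<in> borel_measurable (M i)" and i: "i \<in> I"
  shows "(\<integral>\<^sup>+w. f (w i) \<partial>PiM I M) = (\<integral>\<^sup>+x. f x \<partial>M i)"
  using f i nn_integral_distr[of "\<lambda>w. w i" "PiM I M" "M i" f] by (simp add: PiM_component)

lemma nn_integral_PiM_fun_upd:
  assumes f: "f \<in> borel_measurable (PiM I M)" and i: "i \<in> I"
  shows "(\<integral>\<^sup>+w. f w \<partial>PiM I M) = (\<integral>\<^sup>+w. \<integral>\<^sup>+x. f (w(i := x)) \<partial>M i \<partial>PiM I M)"
proof -
  have I: "I - (I - {i}) = {i}" "insert i I = I" using i by auto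
  have "(\<integral>\<^sup>+w. f w \<partial>PiM I M)
      = (\<integral>\<^sup>+w. \<integral>\<^sup>+w'. f (merge (I - {i}) {i} (w, w')) \<partial>PiM I M \<partial>PiM I M)"
    using nn_integral_PiM_merge[OF f, of "I - {i}"] by (simp add: I)
  also have "\<dots> = (\<integral>\<^sup>+w. \<integral>\<^sup>+w'. f (w(i := w' i)) \<partial>PiM I M \<partial>PiM I M)"
  proof (intro nn_integral_cong)
    fix w w' assume "w \<in> space (PiM I M)"
    then have "merge (I - {i}) {i} (w, w') = w(i := w' i)"
      using i by (auto simp: merge_def space_PiM PiE_iff extensional_def fun_eq_iff)
    then show "f (merge (I - {i}) {i} (w, w')) = f (w(i := w' i))" by simp
  qed
  also have "\<dots> = (\<integral>\<^sup>+w. \<integral>\<^sup>+x. f (w(i := x)) \<partial>M i \<partial>PiM I M)"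
  proof (intro nn_integral_cong nn_integral_PiM_component i)
    fix w assume "w \<in> space (PiM I M)"
    then show "(\<lambda>x. f (w(i := x))) \<in> borel_measurable (M i)"
      using i by (intro measurable_compose[OF _ f] measurable_fun_upd[of I I]) (auto simp: I)
  qed
  finally show ?thesis .
qed

lemma AE_PiM_fun_updI:
  assumes Q: "Measurable.pred (PiM I M) Q" and i: "i \<in> I"
    and AE: "\<And>w. w \<in> space (PiM I M) \<Longrightarrow> AE x in M i. Q (w(i := x))"
  shows "AE w in PiM I M. Q w"
proof -
  let ?f = "\<lambda>w. indicator {w \<in> space (PiM I M). \<not> Q w} w :: ennreal"
  have "(\<integral>\<^sup>+x. ?f (w(i := x)) \<partial>M i) = (\<integral>\<^sup>+x. 0 \<partial>M i)" if "w \<in> space (PiM I M)" for w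
    using AE[OF that] by (intro nn_integral_cong_AE) (auto elim!: eventually_mono)
  then have "(\<integral>\<^sup>+w. ?f w \<partial>PiM I M) = 0"
    using Q i by (subst nn_integral_PiM_fun_upd[of _ i]) (simp_all cong: nn_integral_cong)
  then show ?thesis
    using Q by (simp add: AE_iff_measurable[OF _ refl])
qed

lemma nn_integral_PiM_prod:
  assumes J: "finite J" "J \<subseteq> I" and f: "\<And>j. j \<in> J \<Longrightarrow> f j \<in> borel_measurable (M j)"
  shows "(\<integral>\<^sup>+w. (\<Prod>j\<in>J. f j (w j)) \<partial>PiM I M) = (\<Prod>j\<in>J. \<integral>\<^sup>+x. f j x \<partial>M j)"
proof -
  have "(\<integral>\<^sup>+w. (\<Prod>j\<in>J. f j (w j)) \<partial>PiM I M)
      = (\<integral>\<^sup>+w. (\<Prod>j\<in>J. f j (w j)) \<partial>distr (PiM I M) (PiM J M) (\<lambda>w. restrict w J))"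
    using J f by (subst nn_integral_distr)
      (auto intro!: measurable_restrict_subset cong: prod.cong nn_integral_cong)
  then show ?thesis
    using J f by (simp add: distr_PiM_restrict_finite product_nn_integral_prod)
qed

lemma distr_PiM_map:
  assumes f: "\<And>i. f i \<in> M i \<rightarrow>\<^sub>M M' i"
  shows "distr (PiM I M) (PiM I M') (\<lambda>w. \<lambda>i\<in>I. f i (w i)) = PiM I (\<lambda>i. distr (M i) (M' i) (f i))"
proof -
  interpret image: product_prob_space "\<lambda>i. distr (M i) (M' i) (f i)" I
    by (intro product_prob_spaceI M.prob_space_distr f)
  have measurable_map: "(\<lambda>w. \<lambda>i\<in>I. f i (w i)) \<in> PiM I M \<rightarrow>\<^sub>M PiM I M'"
  proof (rule measurable_restrict)
    show "(\<lambda>w. f i (w i)) \<in> PiM I M \<rightarrow>\<^sub>M M' i" if "i \<in> I" for i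
      by (rule measurable_compose[OF measurable_component_singleton[OF that] f])
  qed
  have sets_image: "sets (PiM I (\<lambda>i. distr (M i) (M' i) (f i))) = sets (PiM I M')"
    by (intro sets_PiM_cong) auto
  show ?thesis
  proof (rule image.PiM_eq)
    fix J F assume J: "finite J" "J \<subseteq> I" and F: "\<And>j. j \<in> J \<Longrightarrow> F j \<in> sets (distr (M j) (M' j) (f j))"
    let ?box = "prod_emb I (\<lambda>i. distr (M i) (M' i) (f i)) J (Pi\<^sub>E J F)"
    have "(\<lambda>w. \<lambda>i\<in>I. f i (w i)) -` ?box \<inter> space (PiM I M) = prod_emb I M J (\<Pi>\<^sub>E j\<in>J. f j -` F j \<inter> space (M j))"
      using J(2) measurable_space[OF f] by (fastforce simp: prod_emb_iff space_PiM PiE_iff)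
    moreover have "?box \<in> sets (PiM I M')"
      unfolding sets_image[symmetric] using J F by (intro sets_PiM_I) auto
    ultimately have "emeasure (distr (PiM I M) (PiM I M') (\<lambda>w. \<lambda>i\<in>I. f i (w i))) ?box
        = (\<Prod>j\<in>J. emeasure (M j) (f j -` F j \<inter> space (M j)))"
      using J F measurable_sets[OF f] by (simp add: emeasure_distr[OF measurable_map] emeasure_PiM_emb)
    also have "\<dots> = (\<Prod>j\<in>J. emeasure (distr (M j) (M' j) (f j)) (F j))"
      using F f by (intro prod.cong) (simp_all add: emeasure_distr)
    finally show "emeasure (distr (PiM I M) (PiM I M') (\<lambda>w. \<lambda>i\<in>I. f i (w i))) ?box
        = (\<Prod>j\<in>J. emeasure (distr (M j) (M' j) (f j)) (F j))" .
  qed (simp add: sets_image)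
qed

end

section \<open>Measures of full support\<close>

definition full_support :: "'a::topological_space measure \<Rightarrow> bool" where
  "full_support M \<longleftrightarrow> (\<forall>U. open U \<longrightarrow> U \<noteq> {} \<longrightarrow> emeasure M U > 0)"

lemma full_support_density_lborel:
  fixes f :: "'a::euclidean_space \<Rightarrow> real"
  assumes [measurable]: "f \<in> borel_measurable borel" and pos: "\<And>x. f x > 0"
  shows "full_support (density lborel f)"
  unfolding full_support_def
proof (intro allI impI)
  fix U :: "'a set" assume U: "open U" "U \<noteq> {}"
  have "emeasure (density lborel f) U \<noteq> 0"
  proof
    assume "emeasure (density lborel f) U = 0"
    then have "U \<in> null_sets (density lborel f)" using U by auto
    then have "AE x\<in>U in lborel. ennreal (f x) = 0"
      by (simp add: null_sets_density_iff)
    then have "AE x in lborel. x \<notin> U"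
      by eventually_elim (metis ennreal_eq_0_iff not_less pos)
    then have "U \<in> null_sets lborel"
      using U by (subst AE_iff_null_sets) auto
    then have "negligible U"
      unfolding negligible_iff_null_sets by (rule null_sets_completionI)
    then show False
      using open_not_negligible U by blast
  qed
  then show "emeasure (density lborel f) U > 0"
    by (simp add: zero_less_iff_neq_zero)
qed

lemma full_support_PiM:
  fixes M :: "'i::countable \<Rightarrow> 'a::second_countable_topology measure"
  assumes "product_prob_space M" and sets: "\<And>i. sets (M i) = sets borel"
    and supp: "\<And>i. full_support (M i)"
  shows "full_support (PiM UNIV M)"
  unfolding full_support_def
proof (intro allI impI)
  interpret product_prob_space M UNIV by fact
  fix U :: "('i \<Rightarrow> 'a) set" assume U: "open U" "U \<noteq> {}"
  then obtain x where "x \<in> U" by auto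
  then obtain X where X: "x \<in> Pi\<^sub>E UNIV X" "\<And>i. open (X i)" "finite {i. X i \<noteq> UNIV}" "Pi\<^sub>E UNIV X \<subseteq> U"
    using product_topology_open_contains_basis[of "\<lambda>_. euclidean" UNIV U x] U(1)
    by (auto simp: open_fun_def)
  define J where "J = {i. X i \<noteq> UNIV}"
  have "prod_emb UNIV M J (Pi\<^sub>E J X) = Pi\<^sub>E UNIV X"
    using sets_eq_imp_space_eq[OF sets] by (auto simp: prod_emb_def J_def PiE_iff) (metis UNIV_I)
  then have "emeasure (PiM UNIV M) (Pi\<^sub>E UNIV X) = (\<Prod>i\<in>J. emeasure (M i) (X i))"
    using emeasure_PiM_emb[of J X] X by (simp add: J_def sets)
  moreover have "emeasure (M i) (X i) \<noteq> 0" for i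
    using supp[of i] X(1) X(2)[of i] unfolding full_support_def PiE_iff by (metis UNIV_I empty_iff less_irrefl)
  ultimately have "0 < emeasure (PiM UNIV M) (Pi\<^sub>E UNIV X)"
    using X(3) by (simp add: J_def zero_less_iff_neq_zero)
  also have "\<dots> \<le> emeasure (PiM UNIV M) U"
    using X(4) borel_open[OF U(1)] sets_PiM_cong[of UNIV UNIV M "\<lambda>_. borel"] sets
    by (intro emeasure_mono) (simp_all add: sets_PiM_equal_borel)
  finally show "0 < emeasure (PiM UNIV M) U" .
qed

lemma integral_less_full_support:
  fixes f g :: "'a::topological_space \<Rightarrow> real"
  assumes "finite_measure M" and supp: "full_support M"
    and int: "integrable M f" "integrable M g"
    and cont: "continuous_on UNIV f" "continuous_on UNIV g"
    and f_le_g: "AE x in M. f x \<le> g x" and less: "f x\<^sub>0 < g x\<^sub>0"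
  shows "(\<integral>x. f x \<partial>M) < (\<integral>x. g x \<partial>M)"
proof (rule finite_measure.integral_less_AE[OF \<open>finite_measure M\<close> int _ _ _ f_le_g])
  have "open {x. f x < g x}" using cont by (intro open_Collect_less)
  then have "emeasure M {x. f x < g x} > 0"
    using supp less unfolding full_support_def by blast
  then show "emeasure M {x. f x < g x} \<noteq> 0" "{x. f x < g x} \<in> sets M"
    by (simp, metis emeasure_notin_sets less_irrefl)
qed simp

lemma full_support_not_AE_le:
  fixes f :: "'a::topological_space \<Rightarrow> real"
  assumes supp: "full_support M" and cont: "continuous_on UNIV f" and less: "c < f x\<^sub>0"
  shows "\<not> (AE x in M. f x \<le> c)"
proof
  assume AE: "AE x in M. f x \<le> c"
  have "open {x. c < f x}" using cont by (intro open_Collect_less continuous_on_const)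
  then have pos: "emeasure M {x. c < f x} > 0"
    using supp less unfolding full_support_def by blast
  then have "{x. c < f x} \<in> sets M" by (metis emeasure_notin_sets less_irrefl)
  moreover from this have "{x \<in> space M. \<not> f x \<le> c} = {x. c < f x}"
    using sets.sets_into_space by (auto simp: not_le)
  ultimately show False
    using AE pos by (simp add: AE_iff_measurable)
qed

section \<open>Moment generating functions\<close>

lemma exp_gt_add_one:
  fixes x :: real
  assumes "x \<noteq> 0"
  shows "1 + x < exp x"
proof -
  have "exp x \<noteq> 1 + x"
    using ln_eq_minus_one[of "exp x"] assms by auto
  then show ?thesis
    using exp_ge_add_one_self[of x] by linarith
qed

lemma exp_mult_less_interpolation:
  fixes t y :: real
  assumes t: "0 < t" "t < 1" and y: "y \<noteq> 0"
  shows "exp (t * y) < t * exp y + (1 - t)"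
proof -
  have "1 = t * (1 + (1 - t) * y) + (1 - t) * (1 + - t * y)"
    by (simp add: algebra_simps)
  also have "\<dots> < t * exp ((1 - t) * y) + (1 - t) * exp (- t * y)"
    using t y by (intro add_strict_mono mult_strict_left_mono exp_gt_add_one) auto
  finally have "exp (t * y) * 1 < exp (t * y) * (t * exp ((1 - t) * y) + (1 - t) * exp (- t * y))"
    by (rule mult_strict_left_mono) simp
  also have "\<dots> = t * exp y + (1 - t)"
    by (simp add: distrib_left mult.left_commute exp_add[symmetric] algebra_simps)
  finally show ?thesis by simp
qed

lemma exp_mult_le_interpolation:
  fixes t y :: real
  assumes "0 \<le> t" "t \<le> 1"
  shows "exp (t * y) \<le> t * exp y + (1 - t)"
  using exp_mult_less_interpolation[of t y] assms by (cases "t = 0 \<or> t = 1 \<or> y = 0") auto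

lemma LIMSEQ_exp_difference_quotient:
  fixes y :: real
  shows "(\<lambda>n. real (Suc n) * (exp (y / real (Suc n)) - 1)) \<longlonglongrightarrow> y"
proof -
  have "((\<lambda>h. exp (h * y)) has_real_derivative y) (at 0)"
    by (auto intro!: derivative_eq_intros)
  then have "((\<lambda>h. (exp (h * y) - 1) / h) \<longlongrightarrow> y) (at 0)"
    by (simp add: has_field_derivative_iff)
  moreover have "filterlim (\<lambda>n. inverse (real (Suc n))) (at 0) sequentially"
    by (intro filterlim_atI LIMSEQ_inverse_real_of_nat) simp
  ultimately have "(\<lambda>n. (exp (inverse (real (Suc n)) * y) - 1) / inverse (real (Suc n))) \<longlonglongrightarrow> y"
    by (rule filterlim_compose)
  then show ?thesis
    by (simp add: divide_inverse mult.commute)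
qed

context prob_space
begin

definition mgf :: "('a \<Rightarrow> real) \<Rightarrow> real \<Rightarrow> real" where
  "mgf Y s = expectation (\<lambda>x. exp (s * Y x))"

lemma mgf_0: "mgf Y 0 = 1"
  by (simp add: mgf_def prob_space)

lemma mgf_uminus: "mgf (\<lambda>x. - Y x) s = mgf Y (- s)"
  by (simp add: mgf_def)

lemma mgf_pos:
  assumes "integrable M (\<lambda>x. exp (s * Y x))"
  shows "mgf Y s > 0"
proof -
  have "expectation (\<lambda>x. 0) < mgf Y s"
    unfolding mgf_def using assms emeasure_space_1 by (intro integral_less_AE_space) auto
  then show ?thesis by simp
qed

lemma integrable_exp_mult_le:
  fixes Y :: "'a \<Rightarrow> real"
  assumes [measurable]: "Y \<in> borel_measurable M"
    and int: "integrable M (\<lambda>x. exp (t * Y x))" and s: "0 \<le> s" "s \<le> t"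
  shows "integrable M (\<lambda>x. exp (s * Y x))"
proof (rule Bochner_Integration.integrable_bound)
  show "integrable M (\<lambda>x. exp (t * Y x) + 1)" using int by simp
  have "exp (s * y) \<le> exp (t * y) + 1" for y
  proof (cases "y \<ge> 0")
    case True
    then have "exp (s * y) \<le> exp (t * y)" using s by (simp add: mult_right_mono)
    then show ?thesis by linarith
  next
    case False
    then have "exp (s * y) \<le> 1" using s by (simp add: mult_nonneg_nonpos)
    then show ?thesis by (simp add: add_increasing)
  qed
  then show "AE x in M. norm (exp (s * Y x)) \<le> norm (exp (t * Y x) + 1)"
    by (simp add: add_pos_pos)
qed simp

lemma integrable_of_exp:
  fixes Y :: "'a \<Rightarrow> real"
  assumes [measurable]: "Y \<in> borel_measurable M" and \<delta>: "\<delta> > 0"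
    and int: "integrable M (\<lambda>x. exp (\<delta> * Y x))" "integrable M (\<lambda>x. exp (- \<delta> * Y x))"
  shows "integrable M Y"
proof (rule Bochner_Integration.integrable_bound)
  show "integrable M (\<lambda>x. (exp (\<delta> * Y x) + exp (- \<delta> * Y x)) / \<delta>)"
    using int by simp
  have "\<bar>y\<bar> \<le> (exp (\<delta> * y) + exp (- \<delta> * y)) / \<delta>" for y
  proof -
    have "\<delta> * y \<le> exp (\<delta> * y)" "- \<delta> * y \<le> exp (- \<delta> * y)"
      using exp_ge_add_one_self[of "\<delta> * y"] exp_ge_add_one_self[of "- \<delta> * y"] by linarith+
    moreover have "0 < exp (\<delta> * y)" "0 < exp (- \<delta> * y)" by simp_all
    ultimately have "\<bar>\<delta> * y\<bar> \<le> exp (\<delta> * y) + exp (- \<delta> * y)" by linarith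
    then show ?thesis
      using \<delta> by (simp add: pos_le_divide_eq abs_mult mult.commute)
  qed
  then show "AE x in M. norm (Y x) \<le> norm ((exp (\<delta> * Y x) + exp (- \<delta> * Y x)) / \<delta>)"
    using \<delta> by (simp add: add_pos_pos)
qed simp

lemma LIMSEQ_mgf_difference_quotient:
  assumes Y: "integrable M Y" and expY: "integrable M (\<lambda>x. exp (Y x))"
  shows "(\<lambda>n. real (Suc n) * (mgf Y (inverse (real (Suc n))) - 1)) \<longlonglongrightarrow> expectation Y"
proof -
  have [measurable]: "Y \<in> borel_measurable M" using Y by auto
  define F where "F n x = real (Suc n) * (exp (Y x / real (Suc n)) - 1)" for n :: nat and x
  have bounds: "Y x \<le> F n x" "F n x \<le> exp (Y x)" for n x
  proof -
    show "Y x \<le> F n x"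
      using exp_ge_add_one_self[of "Y x / real (Suc n)"] by (simp add: F_def field_simps del: of_nat_Suc)
    have "exp (Y x / real (Suc n)) \<le> inverse (real (Suc n)) * exp (Y x) + (1 - inverse (real (Suc n)))"
      using exp_mult_le_interpolation[of "inverse (real (Suc n))" "Y x"]
      by (simp add: divide_inverse mult.commute inverse_le_1_iff)
    then have "F n x \<le> exp (Y x) - 1"
      unfolding F_def by (simp add: field_simps del: of_nat_Suc)
    then show "F n x \<le> exp (Y x)" by simp
  qed
  have "(\<lambda>n. expectation (F n)) \<longlonglongrightarrow> expectation Y"
  proof (rule integral_dominated_convergence)
    show "integrable M (\<lambda>x. \<bar>Y x\<bar> + exp (Y x))" using Y expY by auto
    show "AE x in M. (\<lambda>n. F n x) \<longlonglongrightarrow> Y x"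
      unfolding F_def by (intro AE_I2 LIMSEQ_exp_difference_quotient)
    have "\<bar>F n x\<bar> \<le> \<bar>Y x\<bar> + exp (Y x)" for n x
      using bounds(1)[of x n] bounds(2)[of n x] exp_gt_zero[of "Y x"] by linarith
    then show "AE x in M. norm (F n x) \<le> \<bar>Y x\<bar> + exp (Y x)" for n
      by simp
  qed (unfold F_def, measurable)
  moreover have "expectation (F n) = real (Suc n) * (mgf Y (inverse (real (Suc n))) - 1)" for n
    using integrable_exp_mult_le[of Y 1 "inverse (real (Suc n))"] expY
    by (simp add: F_def[abs_def] mgf_def prob_space divide_inverse mult.commute inverse_le_1_iff)
  ultimately show ?thesis by simp
qed

lemma ex_mgf_less_exp:
  assumes Y: "integrable M Y" and \<delta>: "\<delta> > 0" "integrable M (\<lambda>x. exp (\<delta> * Y x))" and \<epsilon>: "\<epsilon> > 0"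
  shows "\<exists>s. 0 < s \<and> s \<le> \<delta> \<and> mgf Y s < exp (s * (expectation Y + \<epsilon>))"
proof -
  have "(\<lambda>n. real (Suc n) * (mgf (\<lambda>x. \<delta> * Y x) (inverse (real (Suc n))) - 1)) \<longlonglongrightarrow> \<delta> * expectation Y"
    using LIMSEQ_mgf_difference_quotient[of "\<lambda>x. \<delta> * Y x"] Y \<delta> by simp
  moreover have "\<delta> * expectation Y < \<delta> * (expectation Y + \<epsilon>)"
    using \<delta>(1) \<epsilon> by (intro mult_strict_left_mono) auto
  ultimately have "\<forall>\<^sub>F n in sequentially. real (Suc n) * (mgf (\<lambda>x. \<delta> * Y x) (inverse (real (Suc n))) - 1)
      < \<delta> * (expectation Y + \<epsilon>)"
    by (rule order_tendstoD)
  then obtain n where n: "real (Suc n) * (mgf (\<lambda>x. \<delta> * Y x) (inverse (real (Suc n))) - 1)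
      < \<delta> * (expectation Y + \<epsilon>)"
    by (auto simp: eventually_sequentially)
  define s where "s = \<delta> / real (Suc n)"
  have "mgf (\<lambda>x. \<delta> * Y x) (inverse (real (Suc n))) = mgf Y s"
    by (simp add: mgf_def s_def divide_inverse mult_ac)
  with n have "mgf Y s < 1 + s * (expectation Y + \<epsilon>)"
    by (simp add: s_def field_simps del: of_nat_Suc)
  also have "\<dots> \<le> exp (s * (expectation Y + \<epsilon>))"
    by (rule exp_ge_add_one_self)
  finally show ?thesis
    using \<delta>(1) by (intro exI[of _ s]) (simp add: s_def divide_le_eq)
qed

lemma mgf_less_interpolation:
  assumes Y [measurable]: "Y \<in> borel_measurable M" and int: "integrable M (\<lambda>x. exp (t * Y x))"
    and s: "0 < s" "s < t" and nz: "\<not> (AE x in M. Y x = 0)"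
  shows "mgf Y s < s / t * mgf Y t + (1 - s / t)"
proof -
  have r: "0 < s / t" "s / t < 1" using s by auto
  have scale: "s * y = s / t * (t * y)" for y using s by simp
  have "mgf Y s < expectation (\<lambda>x. s / t * exp (t * Y x) + (1 - s / t))"
    unfolding mgf_def
  proof (rule integral_less_AE)
    show "integrable M (\<lambda>x. exp (s * Y x))"
      using s by (intro integrable_exp_mult_le[OF Y int]) auto
    show "integrable M (\<lambda>x. s / t * exp (t * Y x) + (1 - s / t))" using int by simp
    show "emeasure M {x \<in> space M. Y x \<noteq> 0} \<noteq> 0"
      using nz by (simp add: AE_iff_measurable[OF _ refl])
    show "AE x in M. x \<in> {x \<in> space M. Y x \<noteq> 0} \<longrightarrow> exp (s * Y x) \<noteq> s / t * exp (t * Y x) + (1 - s / t)"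
      using exp_mult_less_interpolation[OF r, of "t * Y x" for x] s
      unfolding scale by (intro AE_I2) (auto simp: less_le)
    show "AE x in M. exp (s * Y x) \<le> s / t * exp (t * Y x) + (1 - s / t)"
      using exp_mult_le_interpolation[of "s / t" "t * Y x" for x] r unfolding scale by auto
  qed measurable
  also have "\<dots> = s / t * mgf Y t + (1 - s / t)"
    using int by (simp add: mgf_def prob_space)
  finally show ?thesis .
qed

lemma convex_on_mgf:
  assumes S: "convex S" and int: "\<And>s. s \<in> S \<Longrightarrow> integrable M (\<lambda>x. exp (s * Y x))"
  shows "convex_on S (mgf Y)"
proof (rule convex_onI)
  fix t a b :: real assume t: "0 < t" "t < 1" and ab: "a \<in> S" "b \<in> S"
  have mem: "(1 - t) * a + t * b \<in> S"
    using convexD_alt[OF S ab, of t] t by simp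
  have "mgf Y ((1 - t) * a + t * b) \<le> expectation (\<lambda>x. (1 - t) * exp (a * Y x) + t * exp (b * Y x))"
    unfolding mgf_def
  proof (rule integral_mono[OF int[OF mem]])
    show "exp (((1 - t) * a + t * b) * Y x) \<le> (1 - t) * exp (a * Y x) + t * exp (b * Y x)" for x
      using convex_onD[OF exp_convex, of t "a * Y x" "b * Y x"] t by (simp add: algebra_simps)
  qed (use int ab in simp)
  also have "\<dots> = (1 - t) * mgf Y a + t * mgf Y b"
    using int ab by (simp add: mgf_def)
  finally show "mgf Y ((1 - t) *\<^sub>R a + t *\<^sub>R b) \<le> (1 - t) * mgf Y a + t * mgf Y b"
    by simp
qed (rule S)

lemma ex_not_AE_le_of_not_AE_nonpos:
  fixes Y :: "'a \<Rightarrow> real"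
  assumes "\<not> (AE x in M. Y x \<le> 0)"
  shows "\<exists>c>0. \<not> (AE x in M. Y x \<le> c)"
proof (rule ccontr)
  assume "\<not> (\<exists>c>0. \<not> (AE x in M. Y x \<le> c))"
  then have "AE x in M. \<forall>n. Y x \<le> inverse (real (Suc n))"
    by (simp add: AE_all_countable del: of_nat_Suc)
  then have "AE x in M. Y x \<le> 0"
    by eventually_elim (rule LIMSEQ_le_const[OF LIMSEQ_inverse_real_of_nat], auto)
  with assms show False by contradiction
qed

lemma ex_mgf_gt_1:
  assumes [measurable]: "Y \<in> borel_measurable M" and int: "\<And>s. s > 0 \<Longrightarrow> integrable M (\<lambda>x. exp (s * Y x))"
    and pos: "\<not> (AE x in M. Y x \<le> 0)"
  shows "\<exists>s>0. mgf Y s > 1"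
proof -
  obtain c where c_pos: "c > 0" and not_AE_le: "\<not> (AE x in M. Y x \<le> c)"
    using ex_not_AE_le_of_not_AE_nonpos[OF pos] by blast
  define p where "p = prob {x \<in> space M. Y x > c}"
  have "{x \<in> space M. \<not> Y x \<le> c} = {x \<in> space M. Y x > c}" by auto
  then have p: "p > 0"
    using not_AE_le by (simp add: p_def AE_iff_measurable[OF _ refl] emeasure_eq_measure zero_less_measure_iff)
  define s where "s = 1 / (p * c)"
  have s: "s > 0" using p c_pos by (simp add: s_def)
  have "1 < p * (1 + s * c)" using p c_pos by (simp add: s_def field_simps)
  also have "\<dots> \<le> p * exp (s * c)" using p by (intro mult_left_mono exp_ge_add_one_self) simp
  also have "\<dots> = expectation (\<lambda>x. exp (s * c) * indicator {x \<in> space M. Y x > c} x)"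
    by (simp add: p_def)
  also have "\<dots> \<le> mgf Y s"
    unfolding mgf_def
  proof (rule integral_mono)
    show "exp (s * c) * indicator {x \<in> space M. Y x > c} x \<le> exp (s * Y x)" for x
      using s by (auto simp: indicator_def)
  qed (use int[OF s] in \<open>auto simp: emeasure_eq_measure\<close>)
  finally show ?thesis using s by blast
qed

end

locale exp_integrable_rv = prob_space +
  fixes Y :: "'a \<Rightarrow> real"
  assumes integrable_Y: "integrable M Y"
    and integrable_exp: "s > 0 \<Longrightarrow> integrable M (\<lambda>x. exp (s * Y x))"
    and not_AE_nonpos: "\<not> (AE x in M. Y x \<le> 0)"
begin

lemma measurable_Y [measurable]: "Y \<in> borel_measurable M"
  using integrable_Y by auto

lemma mgf_less_1:
  assumes s: "0 < s" "s < t" and t: "mgf Y t \<le> 1"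
  shows "mgf Y s < 1"
proof -
  have "\<not> (AE x in M. Y x = 0)"
    using not_AE_nonpos eventually_mono[of "\<lambda>x. Y x = 0" "ae_filter M" "\<lambda>x. Y x \<le> 0"] by auto
  then have "mgf Y s < s / t * mgf Y t + (1 - s / t)"
    using s integrable_exp by (intro mgf_less_interpolation) auto
  also have "\<dots> \<le> s / t * 1 + (1 - s / t)"
    using s t by (intro add_right_mono mult_left_mono) auto
  finally show ?thesis by simp
qed

lemma continuous_on_mgf: "continuous_on {0<..} (mgf Y)"
  by (intro convex_on_continuous convex_on_mgf) (auto simp: integrable_exp)

lemma ex1_mgf_eq_1:
  assumes "expectation Y < 0"
  shows "\<exists>!\<alpha>. \<alpha> > 0 \<and> mgf Y \<alpha> = 1"
proof (rule ex_ex1I)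
  obtain s where s: "0 < s" "mgf Y s < 1"
    using ex_mgf_less_exp[of Y 1 "- expectation Y"] integrable_Y integrable_exp[of 1] assms by auto
  obtain t where t: "0 < t" "mgf Y t > 1"
    using ex_mgf_gt_1[OF measurable_Y integrable_exp not_AE_nonpos] by blast
  have "s < t" using mgf_less_1[of t s] s t by (cases s t rule: linorder_cases) auto
  moreover have "continuous_on {s..t} (mgf Y)"
    using s by (intro continuous_on_subset[OF continuous_on_mgf]) auto
  ultimately obtain \<alpha> where "s \<le> \<alpha>" "\<alpha> \<le> t" "mgf Y \<alpha> = 1"
    using IVT'[of "mgf Y" s 1 t] s t by auto
  then show "\<exists>\<alpha>. \<alpha> > 0 \<and> mgf Y \<alpha> = 1" using s by (intro exI[of _ \<alpha>]) auto
next
  fix \<alpha> \<beta> assume "\<alpha> > 0 \<and> mgf Y \<alpha> = 1" "\<beta> > 0 \<and> mgf Y \<beta> = 1"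
  then show "\<alpha> = \<beta>"
    using mgf_less_1[of \<alpha> \<beta>] mgf_less_1[of \<beta> \<alpha>] by (cases \<alpha> \<beta> rule: linorder_cases) auto
qed

end

section \<open>Almost sure exponential growth rates\<close>

context prob_space
begin

lemma AE_eventually_less_power:
  fixes X :: "nat \<Rightarrow> 'a \<Rightarrow> real"
  assumes [measurable]: "\<And>k. X k \<in> borel_measurable M"
    and bound: "\<And>k. (\<integral>\<^sup>+x. ennreal (X k x) \<partial>M) \<le> ennreal (C * q ^ k)"
    and q: "0 \<le> q" "q < c"
  shows "AE x in M. \<forall>\<^sub>F k in sequentially. X k x < c ^ k"
proof -
  define A where "A k = {x \<in> space M. c ^ k \<le> X k x}" for k
  define B where "B = max C 0"
  have c_pos: "c > 0" using q by simp
  have [measurable]: "A k \<in> sets M" for k unfolding A_def by measurable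
  have markov: "prob (A k) \<le> B * (q / c) ^ k" for k
  proof -
    have "A k = {x \<in> space M. 1 \<le> ennreal (1 / c ^ k) * ennreal (X k x)}"
      using c_pos by (simp add: A_def ennreal_mult'[symmetric] ennreal_ge_1 pos_le_divide_eq)
    then have "emeasure M (A k) \<le> ennreal (1 / c ^ k) * (\<integral>\<^sup>+x. ennreal (X k x) \<partial>M)"
      using nn_integral_Markov_inequality[of "\<lambda>x. ennreal (X k x)" "space M" M "ennreal (1 / c ^ k)"]
      by (simp cong: nn_integral_cong)
    also have "\<dots> \<le> ennreal (1 / c ^ k) * ennreal (B * q ^ k)"
      using q by (intro mult_left_mono order_trans[OF bound] ennreal_leI mult_right_mono) (auto simp: B_def)
    also have "\<dots> = ennreal (B * (q / c) ^ k)"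
      using c_pos by (simp add: ennreal_mult'[symmetric] power_divide)
    finally show ?thesis
      using q c_pos by (simp add: emeasure_eq_measure ennreal_le_iff B_def)
  qed
  have "summable (\<lambda>k. B * (q / c) ^ k)"
    using q c_pos by (intro summable_mult summable_geometric) simp
  then have "summable (\<lambda>k. prob (A k))"
    by (rule summable_comparison_test'[where N = 0]) (use markov in simp)
  then have "AE x in M. \<forall>\<^sub>F k in sequentially. x \<in> space M - A k"
    by (intro borel_cantelli_AE1) (auto simp: emeasure_eq_measure)
  then show ?thesis
    by eventually_elim (auto simp: A_def not_le elim: eventually_mono)
qed

lemma AE_eventually_less_rate:
  assumes Y: "integrable M Y" and \<delta>: "\<delta> > 0" "integrable M (\<lambda>x. exp (\<delta> * Y x))"
    and [measurable]: "\<And>k. L k \<in> borel_measurable M"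
    and bound: "\<And>s. 0 < s \<Longrightarrow> s \<le> \<delta> \<Longrightarrow> \<exists>C. \<forall>k. (\<integral>\<^sup>+x. ennreal (exp (s * L k x)) \<partial>M) \<le> ennreal (C * mgf Y s ^ k)"
    and \<epsilon>: "\<epsilon> > 0"
  shows "AE x in M. \<forall>\<^sub>F k in sequentially. L k x < real k * (expectation Y + \<epsilon>)"
proof -
  obtain s where s: "0 < s" "s \<le> \<delta>" "mgf Y s < exp (s * (expectation Y + \<epsilon>))"
    using ex_mgf_less_exp[OF Y \<delta> \<epsilon>] by blast
  obtain C where C: "\<And>k. (\<integral>\<^sup>+x. ennreal (exp (s * L k x)) \<partial>M) \<le> ennreal (C * mgf Y s ^ k)"
    using bound[OF s(1,2)] by blast
  have "0 \<le> mgf Y s" by (simp add: mgf_def)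
  then have "AE x in M. \<forall>\<^sub>F k in sequentially. exp (s * L k x) < exp (s * (expectation Y + \<epsilon>)) ^ k"
    using C s(3) by (intro AE_eventually_less_power) auto
  moreover have "exp (s * (expectation Y + \<epsilon>)) ^ k = exp (s * (real k * (expectation Y + \<epsilon>)))" for k
    by (simp add: exp_of_nat_mult[symmetric] mult_ac)
  ultimately show ?thesis using s(1) by simp
qed

lemma AE_LIMSEQ_of_eventually_dist:
  fixes f :: "nat \<Rightarrow> 'a \<Rightarrow> 'b::metric_space"
  assumes "\<And>\<epsilon>. \<epsilon> > 0 \<Longrightarrow> AE x in M. \<forall>\<^sub>F k in sequentially. dist (f k x) l < \<epsilon>"
  shows "AE x in M. (\<lambda>k. f k x) \<longlonglongrightarrow> l"
proof -
  have "AE x in M. \<forall>n. \<forall>\<^sub>F k in sequentially. dist (f k x) l < inverse (real (Suc n))"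
    using assms by (simp add: AE_all_countable del: of_nat_Suc)
  then show ?thesis
  proof eventually_elim
    case (elim x)
    show ?case
    proof (rule tendstoI)
      fix \<epsilon> :: real assume "\<epsilon> > 0"
      then obtain n where n: "inverse (real (Suc n)) < \<epsilon>" using reals_Archimedean by blast
      from elim[rule_format, of n] show "\<forall>\<^sub>F k in sequentially. dist (f k x) l < \<epsilon>"
        by eventually_elim (use n in linarith)
    qed
  qed
qed

lemma AE_LIMSEQ_rate:
  assumes Y: "integrable M Y"
    and \<delta>: "\<delta> > 0" "integrable M (\<lambda>x. exp (\<delta> * Y x))" "integrable M (\<lambda>x. exp (- \<delta> * Y x))"
    and L [measurable]: "\<And>k. L k \<in> borel_measurable M"
    and bound: "\<And>s. s \<noteq> 0 \<Longrightarrow> \<bar>s\<bar> \<le> \<delta> \<Longrightarrow>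
      \<exists>C. \<forall>k. (\<integral>\<^sup>+x. ennreal (exp (s * L k x)) \<partial>M) \<le> ennreal (C * mgf Y s ^ k)"
  shows "AE x in M. (\<lambda>k. L k x / real k) \<longlonglongrightarrow> expectation Y"
proof -
  have upper: "AE x in M. \<forall>\<^sub>F k in sequentially. L k x < real k * (expectation Y + \<epsilon>)" if "\<epsilon> > 0" for \<epsilon>
    using Y \<delta> bound that by (intro AE_eventually_less_rate[where \<delta> = \<delta>]) auto
  have lower: "AE x in M. \<forall>\<^sub>F k in sequentially. - L k x < real k * (expectation (\<lambda>x. - Y x) + \<epsilon>)"
    if "\<epsilon> > 0" for \<epsilon>
    using Y \<delta> bound[of "- s" for s] that
    by (intro AE_eventually_less_rate[where \<delta> = \<delta>]) (auto simp: mgf_uminus)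
  show ?thesis
  proof (rule AE_LIMSEQ_of_eventually_dist)
    fix \<epsilon> :: real assume "\<epsilon> > 0"
    from upper[OF this] lower[OF this]
    show "AE x in M. \<forall>\<^sub>F k in sequentially. dist (L k x / real k) (expectation Y) < \<epsilon>"
    proof eventually_elim
      case (elim x)
      from elim eventually_gt_at_top[of 0] show ?case
        by eventually_elim (simp add: dist_real_def abs_diff_less_iff field_simps)
    qed
  qed
qed

end

section \<open>Spectral norm and largest eigenvalue\<close>

definition frob_norm :: "nat \<Rightarrow> real mat \<Rightarrow> real" where
  "frob_norm d A = sqrt (\<Sum>p<d. \<Sum>q<d. (A $$ (p, q))\<^sup>2)"

lemma frob_norm_nonneg [simp]: "frob_norm d A \<ge> 0"
  by (simp add: frob_norm_def sum_nonneg)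

lemma frob_norm_power2: "(frob_norm d A)\<^sup>2 = (\<Sum>p<d. \<Sum>q<d. (A $$ (p, q))\<^sup>2)"
  by (simp add: frob_norm_def sum_nonneg)

lemma vnorm_nonneg [simp]: "vnorm x \<ge> 0"
  by (simp add: vnorm_def scalar_prod_def sum_nonneg)

lemma vnorm_power2: "(vnorm x)\<^sup>2 = x \<bullet> x"
  by (simp add: vnorm_def scalar_prod_def sum_nonneg)

lemma vnorm_eq_L2_set: "x \<in> carrier_vec d \<Longrightarrow> vnorm x = L2_set (($) x) {..<d}"
  by (simp add: vnorm_def L2_set_def scalar_prod_def power2_eq_square lessThan_atLeast0)

lemma vnorm_vec: "vnorm (vec d u) = L2_set u {..<d}"
  by (subst vnorm_eq_L2_set[of _ d]) (auto intro: L2_set_cong)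

lemma vnorm_smult: "vnorm (t \<cdot>\<^sub>v x) = \<bar>t\<bar> * vnorm x"
proof -
  have "vnorm (t \<cdot>\<^sub>v x) = sqrt (t\<^sup>2 * (x \<bullet> x))"
    by (simp add: vnorm_def scalar_prod_def sum_distrib_left power2_eq_square ac_simps)
  then show ?thesis by (simp add: vnorm_def real_sqrt_mult)
qed

lemma vnorm_eq_0_iff: "x \<in> carrier_vec d \<Longrightarrow> vnorm x = 0 \<longleftrightarrow> x = 0\<^sub>v d"
  by (auto simp: vnorm_eq_L2_set L2_set_eq_0_iff intro!: eq_vecI)

lemma vnorm_unit_vec: "j < d \<Longrightarrow> vnorm (unit_vec d j) = 1"
  by (simp add: vnorm_def)

lemma vnorm_mult_mat_vec_le_frob_norm:
  assumes A: "A \<in> carrier_mat d d" and x: "x \<in> carrier_vec d"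
  shows "vnorm (A *\<^sub>v x) \<le> frob_norm d A * vnorm x"
proof (rule power2_le_imp_le)
  have "(vnorm (A *\<^sub>v x))\<^sup>2 = (\<Sum>p<d. (\<Sum>q<d. A $$ (p, q) * x $ q)\<^sup>2)"
    using A x by (subst vnorm_eq_L2_set[of _ d])
      (auto simp: L2_set_def sum_nonneg scalar_prod_def lessThan_atLeast0 intro!: sum.cong)
  also have "\<dots> \<le> (\<Sum>p<d. (\<Sum>q<d. (A $$ (p, q))\<^sup>2) * (\<Sum>q<d. (x $ q)\<^sup>2))"
    by (intro sum_mono Cauchy_Schwarz_ineq_sum)
  also have "\<dots> = (frob_norm d A * vnorm x)\<^sup>2"
    using x by (simp add: power_mult_distrib frob_norm_power2 vnorm_eq_L2_set L2_set_def sum_nonneg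
        sum_distrib_right)
  finally show "(vnorm (A *\<^sub>v x))\<^sup>2 \<le> (frob_norm d A * vnorm x)\<^sup>2" .
qed simp

lemma frob_norm_power2_columns:
  assumes A: "A \<in> carrier_mat d d"
  shows "(frob_norm d A)\<^sup>2 = (\<Sum>j<d. (vnorm (A *\<^sub>v unit_vec d j))\<^sup>2)"
proof -
  have "(vnorm (A *\<^sub>v unit_vec d j))\<^sup>2 = (\<Sum>p<d. (A $$ (p, j))\<^sup>2)" if "j < d" for j
    using A that by (subst vnorm_eq_L2_set[of _ d]) (auto simp: L2_set_def sum_nonneg intro!: sum.cong)
  then show ?thesis
    unfolding frob_norm_power2 by (subst sum.swap) simp
qed

lemma bdd_above_spec_norm:
  assumes "A \<in> carrier_mat d d"
  shows "bdd_above {vnorm (A *\<^sub>v x) | x. x \<in> carrier_vec d \<and> vnorm x = 1}"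
  using vnorm_mult_mat_vec_le_frob_norm[OF assms] by (intro bdd_aboveI[of _ "frob_norm d A"]) force

lemma vnorm_mult_mat_vec_le_spec_norm:
  assumes A: "A \<in> carrier_mat d d" and x: "x \<in> carrier_vec d"
  shows "vnorm (A *\<^sub>v x) \<le> spec_norm d A * vnorm x"
proof (cases "vnorm x = 0")
  case True
  then show ?thesis using vnorm_mult_mat_vec_le_frob_norm[OF A x] by simp
next
  case False
  let ?y = "(1 / vnorm x) \<cdot>\<^sub>v x"
  have y: "?y \<in> carrier_vec d" "vnorm ?y = 1" using x False by (simp_all add: vnorm_smult)
  have "vnorm (A *\<^sub>v ?y) \<le> spec_norm d A"
    unfolding spec_norm_def using y by (intro cSup_upper bdd_above_spec_norm[OF A]) auto
  then have "vnorm (A *\<^sub>v x) / vnorm x \<le> spec_norm d A"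
    using A x by (simp add: mult_mat_vec vnorm_smult)
  moreover have "vnorm x > 0" using False vnorm_nonneg[of x] by linarith
  ultimately show ?thesis by (simp add: pos_divide_le_eq)
qed

lemma less_spec_norm_iff:
  assumes A: "A \<in> carrier_mat d d" and d: "d > 0"
  shows "c < spec_norm d A \<longleftrightarrow> (\<exists>x\<in>carrier_vec d. vnorm x = 1 \<and> c < vnorm (A *\<^sub>v x))"
proof -
  have "{vnorm (A *\<^sub>v x) |x. x \<in> carrier_vec d \<and> vnorm x = 1} \<noteq> {}"
    using d vnorm_unit_vec[of 0 d] unit_vec_carrier[of d 0] by fastforce
  then show ?thesis
    unfolding spec_norm_def by (subst less_cSup_iff) (use bdd_above_spec_norm[OF A] in auto)
qed

lemma spec_norm_nonneg:
  assumes "A \<in> carrier_mat d d" "d > 0"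
  shows "spec_norm d A \<ge> 0"
  using vnorm_mult_mat_vec_le_spec_norm[OF assms(1), of "unit_vec d 0"] assms(2)
    order_trans[OF vnorm_nonneg[of "A *\<^sub>v unit_vec d 0"]] by (simp add: vnorm_unit_vec)

lemma spec_norm_le_frob_norm:
  assumes A: "A \<in> carrier_mat d d" and d: "d > 0"
  shows "spec_norm d A \<le> frob_norm d A"
proof (rule ccontr)
  assume "\<not> spec_norm d A \<le> frob_norm d A"
  then obtain x where "x \<in> carrier_vec d" "vnorm x = 1" "frob_norm d A < vnorm (A *\<^sub>v x)"
    by (auto simp: not_le less_spec_norm_iff[OF A d])
  then show False using vnorm_mult_mat_vec_le_frob_norm[OF A, of x] by simp
qed

lemma scalar_prod_gram_mat:
  fixes A :: "real mat"
  assumes A: "A \<in> carrier_mat d d" and x: "x \<in> carrier_vec d" and y: "y \<in> carrier_vec d"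
  shows "((transpose_mat A * A) *\<^sub>v x) \<bullet> y = (A *\<^sub>v x) \<bullet> (A *\<^sub>v y)"
  using transpose_vec_mult_scalar[OF A y, of "A *\<^sub>v x"] A x
  by (simp add: assoc_mult_mat_vec[of "transpose_mat A" d d A d x])

text \<open>The form is nonnegative at \<open>x - t B x\<close>, and \<open>t = 1 / K\<close> minimises the resulting bound.\<close>

lemma psd_vnorm_mult_mat_vec_le:
  fixes B :: "real mat"
  assumes B: "B \<in> carrier_mat d d" and sym: "transpose_mat B = B"
    and psd: "\<And>x. x \<in> carrier_vec d \<Longrightarrow> 0 \<le> (B *\<^sub>v x) \<bullet> x"
    and bound: "\<And>x. x \<in> carrier_vec d \<Longrightarrow> (B *\<^sub>v x) \<bullet> x \<le> K * (vnorm x)\<^sup>2"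
    and K: "K > 0" and x: "x \<in> carrier_vec d"
  shows "(vnorm (B *\<^sub>v x))\<^sup>2 \<le> K * ((B *\<^sub>v x) \<bullet> x)"
proof -
  define y where "y = B *\<^sub>v x"
  define t where "t = 1 / K"
  have y: "y \<in> carrier_vec d" and By: "B *\<^sub>v y \<in> carrier_vec d" using B x by (auto simp: y_def)
  have "(B *\<^sub>v y) \<bullet> x = y \<bullet> y"
    using transpose_vec_mult_scalar[OF B x y] sym by (simp add: y_def)
  then have expand: "(B *\<^sub>v (x - t \<cdot>\<^sub>v y)) \<bullet> (x - t \<cdot>\<^sub>v y) = y \<bullet> x - 2 * t * (y \<bullet> y) + t\<^sup>2 * ((B *\<^sub>v y) \<bullet> y)"
    using B x y By
    by (simp add: mult_minus_distrib_mat_vec[of _ d d] mult_mat_vec[of _ d d] y_def[symmetric]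
        minus_scalar_prod_distrib[of _ d] scalar_prod_minus_distrib[of _ d] power2_eq_square algebra_simps)
  have "0 \<le> y \<bullet> x - 2 * t * (y \<bullet> y) + t\<^sup>2 * ((B *\<^sub>v y) \<bullet> y)"
    using psd[of "x - t \<cdot>\<^sub>v y"] x y by (simp add: expand)
  also have "\<dots> \<le> y \<bullet> x - 2 * t * (y \<bullet> y) + t\<^sup>2 * (K * (y \<bullet> y))"
    using bound[OF y] by (intro add_left_mono mult_left_mono) (simp_all add: vnorm_power2)
  also have "\<dots> = y \<bullet> x - t * (y \<bullet> y)"
    using K by (simp add: t_def power2_eq_square)
  finally have "y \<bullet> y \<le> K * (y \<bullet> x)"
    using K by (simp add: t_def pos_divide_le_eq mult.commute)
  then show ?thesis by (simp add: y_def vnorm_power2)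
qed

lemma psd_det_nonzero_bounded_below:
  fixes B :: "real mat"
  assumes B: "B \<in> carrier_mat d d" and "transpose_mat B = B"
    and psd: "\<And>x. x \<in> carrier_vec d \<Longrightarrow> 0 \<le> (B *\<^sub>v x) \<bullet> x"
    and "\<And>x. x \<in> carrier_vec d \<Longrightarrow> (B *\<^sub>v x) \<bullet> x \<le> K * (vnorm x)\<^sup>2"
    and K: "K > 0" and det: "det B \<noteq> 0"
  obtains c where "c > 0" "\<And>x. x \<in> carrier_vec d \<Longrightarrow> c * (vnorm x)\<^sup>2 \<le> (B *\<^sub>v x) \<bullet> x"
proof -
  obtain E where E: "E \<in> carrier_mat d d" "E * B = 1\<^sub>m d"
    using det_non_zero_imp_unit[OF B det, of "()"] by (auto simp: Units_def ring_mat_def)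
  define L where "L = (frob_norm d E)\<^sup>2 * K + 1"
  have L: "L > 0" using K by (simp add: L_def add_nonneg_pos)
  show ?thesis
  proof
    show "1 / L > 0" using L by simp
    fix x :: "real vec" assume x: "x \<in> carrier_vec d"
    have Bx: "0 \<le> (B *\<^sub>v x) \<bullet> x" by (rule psd[OF x])
    have "x = E *\<^sub>v (B *\<^sub>v x)" using E B x by (simp add: assoc_mult_mat_vec[symmetric])
    then have "vnorm x \<le> frob_norm d E * vnorm (B *\<^sub>v x)"
      using vnorm_mult_mat_vec_le_frob_norm[OF E(1), of "B *\<^sub>v x"] B x by simp
    then have "(vnorm x)\<^sup>2 \<le> (frob_norm d E)\<^sup>2 * (vnorm (B *\<^sub>v x))\<^sup>2"
      by (metis power_mono power_mult_distrib vnorm_nonneg)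
    also have "\<dots> \<le> (frob_norm d E)\<^sup>2 * (K * ((B *\<^sub>v x) \<bullet> x))"
      by (intro mult_left_mono psd_vnorm_mult_mat_vec_le[OF B assms(2-5) x]) simp_all
    also have "\<dots> \<le> L * ((B *\<^sub>v x) \<bullet> x)"
      using Bx by (simp add: L_def algebra_simps)
    finally show "1 / L * (vnorm x)\<^sup>2 \<le> (B *\<^sub>v x) \<bullet> x"
      using L by (simp add: pos_divide_le_eq mult.commute)
  qed
qed

lemma smult_one_minus_mult_mat_vec:
  fixes S :: "'a::comm_ring_1 mat"
  assumes S: "S \<in> carrier_mat d d" and x: "x \<in> carrier_vec d"
  shows "(k \<cdot>\<^sub>m 1\<^sub>m d - S) *\<^sub>v x = k \<cdot>\<^sub>v x - S *\<^sub>v x"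
proof -
  have "(k \<cdot>\<^sub>m 1\<^sub>m d) *\<^sub>v x = k \<cdot>\<^sub>v x"
    using x by (intro eq_vecI) (auto simp: row_smult)
  then show ?thesis
    using S x by (simp add: minus_mult_distrib_mat_vec[of _ d d])
qed

lemma eigenvalue_of_det_eq_0:
  fixes S :: "'a::field mat"
  assumes S: "S \<in> carrier_mat d d" and "det (k \<cdot>\<^sub>m 1\<^sub>m d - S) = 0"
  shows "eigenvalue S k"
proof -
  have "k \<cdot>\<^sub>m 1\<^sub>m d - S \<in> carrier_mat d d" using S by (rule minus_carrier_mat)
  then obtain x where x: "x \<in> carrier_vec d" "x \<noteq> 0\<^sub>v d" "(k \<cdot>\<^sub>m 1\<^sub>m d - S) *\<^sub>v x = 0\<^sub>v d"
    using det_0_iff_vec_prod_zero assms(2) by blast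
  then have "S *\<^sub>v x = k \<cdot>\<^sub>v x"
    using S by (auto simp: smult_one_minus_mult_mat_vec vec_eq_iff)
  then show ?thesis
    using x(1,2) S by (auto simp: eigenvalue_def eigenvector_def)
qed

lemma eigenvalue_spec_norm:
  assumes A: "A \<in> carrier_mat d d" and d: "d > 0"
  shows "eigenvalue (transpose_mat A * A) ((spec_norm d A)\<^sup>2)"
proof (rule ccontr)
  define \<sigma> where "\<sigma> = spec_norm d A"
  define S where "S = transpose_mat A * A"
  define B where "B = \<sigma>\<^sup>2 \<cdot>\<^sub>m 1\<^sub>m d - S"
  have \<sigma>: "\<sigma> \<ge> 0" using spec_norm_nonneg[OF A d] by (simp add: \<sigma>_def)
  have S: "S \<in> carrier_mat d d" using A by (simp add: S_def)
  then have B: "B \<in> carrier_mat d d" unfolding B_def by (rule minus_carrier_mat)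
  have form_B: "(B *\<^sub>v x) \<bullet> x = \<sigma>\<^sup>2 * (vnorm x)\<^sup>2 - (vnorm (A *\<^sub>v x))\<^sup>2" if x: "x \<in> carrier_vec d" for x
    using S x scalar_prod_gram_mat[OF A x x]
    by (simp add: B_def smult_one_minus_mult_mat_vec minus_scalar_prod_distrib[of _ d] vnorm_power2
        S_def[symmetric])
  have psd: "0 \<le> (B *\<^sub>v x) \<bullet> x" if "x \<in> carrier_vec d" for x
    using power_mono[OF vnorm_mult_mat_vec_le_spec_norm[OF A that] vnorm_nonneg, of 2] that
    by (simp add: form_B \<sigma>_def power_mult_distrib)
  assume "\<not> eigenvalue (transpose_mat A * A) ((spec_norm d A)\<^sup>2)"
  then have "det B \<noteq> 0"
    using eigenvalue_of_det_eq_0[OF S] by (auto simp: B_def S_def \<sigma>_def)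
  moreover have "transpose_mat B = B"
  proof -
    have "transpose_mat (\<sigma>\<^sup>2 \<cdot>\<^sub>m 1\<^sub>m d) = \<sigma>\<^sup>2 \<cdot>\<^sub>m 1\<^sub>m d" by (intro eq_matI) auto
    then show ?thesis
      using A by (simp add: B_def S_def transpose_minus[of _ d d] transpose_mult[of _ d d _ d])
  qed
  moreover have "(B *\<^sub>v x) \<bullet> x \<le> (\<sigma>\<^sup>2 + 1) * (vnorm x)\<^sup>2" if "x \<in> carrier_vec d" for x
    using that by (simp add: form_B algebra_simps)
  moreover have "\<sigma>\<^sup>2 + 1 > 0" by (simp add: add_nonneg_pos)
  ultimately obtain c where c_pos: "c > 0"
    and form_ge: "\<And>x. x \<in> carrier_vec d \<Longrightarrow> c * (vnorm x)\<^sup>2 \<le> (B *\<^sub>v x) \<bullet> x"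
    using psd_det_nonzero_bounded_below[OF B _ psd] by metis
  have "vnorm (A *\<^sub>v x) \<le> sqrt (\<sigma>\<^sup>2 - c)" if "x \<in> carrier_vec d" "vnorm x = 1" for x
    using form_ge[OF that(1)] that by (intro real_le_rsqrt) (simp add: form_B)
  then have "\<sigma> \<le> sqrt (\<sigma>\<^sup>2 - c)"
    unfolding \<sigma>_def by (meson less_spec_norm_iff[OF A d] not_less)
  also have "\<dots> < sqrt (\<sigma>\<^sup>2)" using c_pos by (intro real_sqrt_less_mono) simp
  finally show False using \<sigma> by simp
qed

lemma lambda_max_gram_mat:
  assumes A: "A \<in> carrier_mat d d" and d: "d > 0"
  shows "lambda_max (transpose_mat A * A) = (spec_norm d A)\<^sup>2"
  unfolding lambda_max_def
proof (rule Max_eqI)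
  let ?S = "transpose_mat A * A"
  have S: "?S \<in> carrier_mat d d" using A by simp
  have "char_poly ?S \<noteq> 0"
    using degree_monic_char_poly[OF S] d by auto
  then show "finite {l. eigenvalue ?S l}"
    using poly_roots_finite[of "char_poly ?S"] by (simp add: eigenvalue_root_char_poly[OF S])
  show "(spec_norm d A)\<^sup>2 \<in> {l. eigenvalue ?S l}"
    using eigenvalue_spec_norm[OF assms] by simp
  fix l assume "l \<in> {l. eigenvalue ?S l}"
  then obtain x where x: "x \<in> carrier_vec d" "x \<noteq> 0\<^sub>v d" "?S *\<^sub>v x = l \<cdot>\<^sub>v x"
    using S by (auto simp: eigenvalue_def eigenvector_def)
  have "l * (vnorm x)\<^sup>2 = (vnorm (A *\<^sub>v x))\<^sup>2"
    using scalar_prod_gram_mat[OF A x(1) x(1)] x by (simp add: vnorm_power2)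
  also have "\<dots> \<le> (spec_norm d A * vnorm x)\<^sup>2"
    by (intro power_mono vnorm_mult_mat_vec_le_spec_norm[OF A x(1)]) simp
  finally have "l * (vnorm x)\<^sup>2 \<le> (spec_norm d A)\<^sup>2 * (vnorm x)\<^sup>2"
    by (simp add: power_mult_distrib)
  moreover have "(vnorm x)\<^sup>2 > 0" using vnorm_eq_0_iff[OF x(1)] x(2) by simp
  ultimately show "l \<le> (spec_norm d A)\<^sup>2" by (rule mult_right_le_imp_le)
qed

section \<open>Rotation invariance of the normal distribution\<close>

lemma nn_integral_lborel_shear:
  fixes F :: "real \<Rightarrow> real \<Rightarrow> ennreal" and h :: "real \<Rightarrow> real"
  assumes "\<And>x. F x \<in> borel_measurable borel"
  shows "(\<integral>\<^sup>+x. \<integral>\<^sup>+y. F x (h x + y) \<partial>lborel \<partial>lborel) = (\<integral>\<^sup>+x. \<integral>\<^sup>+y. F x y \<partial>lborel \<partial>lborel)"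
  using assms nn_integral_real_affine[of "F x" 1 "h x" for x] by simp

lemma nn_integral_lborel_shear':
  fixes F :: "real \<Rightarrow> real \<Rightarrow> ennreal" and h :: "real \<Rightarrow> real"
  assumes F [measurable]: "case_prod F \<in> borel_measurable (borel \<Otimes>\<^sub>M borel)"
    and [measurable]: "h \<in> borel_measurable borel"
  shows "(\<integral>\<^sup>+x. \<integral>\<^sup>+y. F (h y + x) y \<partial>lborel \<partial>lborel) = (\<integral>\<^sup>+x. \<integral>\<^sup>+y. F x y \<partial>lborel \<partial>lborel)"
proof -
  have "(\<integral>\<^sup>+x. \<integral>\<^sup>+y. F (h y + x) y \<partial>lborel \<partial>lborel) = (\<integral>\<^sup>+y. \<integral>\<^sup>+x. F (h y + x) y \<partial>lborel \<partial>lborel)"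
    by (intro lborel_pair.Fubini') simp
  also have "\<dots> = (\<integral>\<^sup>+y. \<integral>\<^sup>+x. F x y \<partial>lborel \<partial>lborel)"
    by (intro nn_integral_lborel_shear) simp
  also have "\<dots> = (\<integral>\<^sup>+x. \<integral>\<^sup>+y. F x y \<partial>lborel \<partial>lborel)"
    by (intro lborel_pair.Fubini'[symmetric]) simp
  finally show ?thesis .
qed

lemma rotation_eq_shears:
  fixes c s t x y :: real
  assumes st: "s * t = 1 - c" and tc: "t * (1 + c) = s"
  shows "s * (- t * y + x) + y = s * x + c * y"
    and "- t * (s * x + c * y) + (- t * y + x) = c * x - s * y"
proof -
  have "s * (- t * y + x) + y = s * x + (1 - s * t) * y"
    by (simp add: algebra_simps)
  then show "s * (- t * y + x) + y = s * x + c * y"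
    by (simp add: st)
  have "- t * (s * x + c * y) + (- t * y + x) = (1 - s * t) * x - (t * (1 + c)) * y"
    by (simp add: algebra_simps)
  then show "- t * (s * x + c * y) + (- t * y + x) = c * x - s * y"
    by (simp add: st tc)
qed

lemma nn_integral_lborel_rotate:
  fixes F :: "real \<Rightarrow> real \<Rightarrow> ennreal" and c s :: real
  assumes F [measurable]: "case_prod F \<in> borel_measurable (borel \<Otimes>\<^sub>M borel)"
    and cs: "c\<^sup>2 + s\<^sup>2 = 1" and s: "s \<noteq> 0"
  shows "(\<integral>\<^sup>+x. \<integral>\<^sup>+y. F (c * x - s * y) (s * x + c * y) \<partial>lborel \<partial>lborel)
       = (\<integral>\<^sup>+x. \<integral>\<^sup>+y. F x y \<partial>lborel \<partial>lborel)"
proof -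
  define t where "t = (1 - c) / s"
  have "s * t = 1 - c" "t * (1 + c) = s"
    using s cs by (simp_all add: t_def field_simps power2_eq_square)
  note shears = rotation_eq_shears[OF this]
  define G where "G x y = F (- t * y + x) y" for x y
  define H where "H x y = G x (s * x + y)" for x y
  have [measurable]: "case_prod G \<in> borel_measurable (borel \<Otimes>\<^sub>M borel)"
    unfolding G_def by simp
  have [measurable]: "case_prod H \<in> borel_measurable (borel \<Otimes>\<^sub>M borel)"
    unfolding H_def by simp
  have "(\<integral>\<^sup>+x. \<integral>\<^sup>+y. F (c * x - s * y) (s * x + c * y) \<partial>lborel \<partial>lborel)
      = (\<integral>\<^sup>+x. \<integral>\<^sup>+y. H (- t * y + x) y \<partial>lborel \<partial>lborel)"
    by (simp only: H_def G_def shears)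
  also have "\<dots> = (\<integral>\<^sup>+x. \<integral>\<^sup>+y. H x y \<partial>lborel \<partial>lborel)"
    by (rule nn_integral_lborel_shear') simp_all
  also have "\<dots> = (\<integral>\<^sup>+x. \<integral>\<^sup>+y. G x y \<partial>lborel \<partial>lborel)"
    unfolding H_def by (rule nn_integral_lborel_shear) simp
  also have "\<dots> = (\<integral>\<^sup>+x. \<integral>\<^sup>+y. F x y \<partial>lborel \<partial>lborel)"
    unfolding G_def by (rule nn_integral_lborel_shear') simp_all
  finally show ?thesis .
qed

lemma normal_density_rotate:
  assumes "c\<^sup>2 + s\<^sup>2 = 1"
  shows "normal_density 0 \<sigma> (c * x - s * y) * normal_density 0 \<sigma> (s * x + c * y)
       = normal_density 0 \<sigma> x * normal_density 0 \<sigma> y"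
proof -
  have "(c * x - s * y)\<^sup>2 + (s * x + c * y)\<^sup>2 = (c\<^sup>2 + s\<^sup>2) * (x\<^sup>2 + y\<^sup>2)"
    by (simp add: power2_eq_square algebra_simps)
  moreover have "normal_density 0 \<sigma> a * normal_density 0 \<sigma> b
      = (1 / sqrt (2 * pi * \<sigma>\<^sup>2))\<^sup>2 * exp (- (a\<^sup>2 + b\<^sup>2) / (2 * \<sigma>\<^sup>2))" for a b
  proof -
    have "- (a\<^sup>2 + b\<^sup>2) / (2 * \<sigma>\<^sup>2) = - a\<^sup>2 / (2 * \<sigma>\<^sup>2) + - b\<^sup>2 / (2 * \<sigma>\<^sup>2)"
      by (simp only: add_divide_distrib[symmetric] minus_add_distrib)
    then show ?thesis
      by (simp only: exp_add normal_density_def diff_0_right power2_eq_square mult_ac)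
  qed
  ultimately show ?thesis using assms by simp
qed

lemma nn_integral_normal_rotate:
  fixes F :: "real \<Rightarrow> real \<Rightarrow> ennreal" and c s \<sigma> :: real
  assumes F [measurable]: "case_prod F \<in> borel_measurable (borel \<Otimes>\<^sub>M borel)"
    and cs: "c\<^sup>2 + s\<^sup>2 = 1" and s: "s \<noteq> 0"
  defines "N \<equiv> density lborel (normal_density 0 \<sigma>)"
  shows "(\<integral>\<^sup>+x. \<integral>\<^sup>+y. F (c * x - s * y) (s * x + c * y) \<partial>N \<partial>N) = (\<integral>\<^sup>+x. \<integral>\<^sup>+y. F x y \<partial>N \<partial>N)"
proof -
  define G where "G x y = ennreal (normal_density 0 \<sigma> x * normal_density 0 \<sigma> y) * F x y" for x y
  have nn_integral_N: "(\<integral>\<^sup>+x. \<integral>\<^sup>+y. H x y \<partial>N \<partial>N)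
      = (\<integral>\<^sup>+x. \<integral>\<^sup>+y. ennreal (normal_density 0 \<sigma> x * normal_density 0 \<sigma> y) * H x y \<partial>lborel \<partial>lborel)"
    if [measurable]: "case_prod H \<in> borel_measurable (borel \<Otimes>\<^sub>M borel)" for H :: "real \<Rightarrow> real \<Rightarrow> ennreal"
  proof -
    have "(\<lambda>x. \<integral>\<^sup>+y. H x y \<partial>N) \<in> borel_measurable borel"
      unfolding N_def by (simp add: nn_integral_density)
    then show ?thesis
      by (simp add: N_def nn_integral_density ennreal_mult' mult.assoc nn_integral_cmult)
  qed
  have "(\<integral>\<^sup>+x. \<integral>\<^sup>+y. F (c * x - s * y) (s * x + c * y) \<partial>N \<partial>N)
      = (\<integral>\<^sup>+x. \<integral>\<^sup>+y. G (c * x - s * y) (s * x + c * y) \<partial>lborel \<partial>lborel)"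
    unfolding G_def normal_density_rotate[OF cs] by (rule nn_integral_N) simp
  also have "\<dots> = (\<integral>\<^sup>+x. \<integral>\<^sup>+y. G x y \<partial>lborel \<partial>lborel)"
    by (rule nn_integral_lborel_rotate[OF _ cs s]) (simp add: G_def)
  also have "\<dots> = (\<integral>\<^sup>+x. \<integral>\<^sup>+y. F x y \<partial>N \<partial>N)"
    unfolding G_def by (rule nn_integral_N[symmetric]) simp
  finally show ?thesis .
qed

section \<open>The Gaussian data space\<close>

locale gaussian_data =
  fixes v :: real
  assumes v_pos: "v > 0"
begin

abbreviation N :: "real measure" where
  "N \<equiv> density lborel (normal_density 0 (sqrt v))"

abbreviation P :: "(nat \<times> nat \<Rightarrow> real) measure" where
  "P \<equiv> data_space v"

lemma prob_space_N: "prob_space N"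
  using v_pos by (intro prob_space_normal_density) simp

lemma PiM_N: "PiM UNIV (\<lambda>_. N) = P"
  by (simp add: data_space_def)

sublocale N: prob_space N
  by (rule prob_space_N)

sublocale data: product_prob_space "\<lambda>_ :: nat \<times> nat. N" UNIV
  rewrites "PiM UNIV (\<lambda>_ :: nat \<times> nat. N) = P"
  by unfold_locales (rule PiM_N)

lemma sets_P [measurable_cong]: "sets P = sets (PiM UNIV (\<lambda>_. borel))"
  unfolding PiM_N[symmetric] by (intro sets_PiM_cong) auto

lemma sets_P_eq_borel: "sets P = sets borel"
  by (simp add: sets_P sets_PiM_equal_borel)

lemma space_P [simp]: "space P = UNIV"
  by (simp add: PiM_N[symmetric] space_PiM PiE_UNIV_domain)

lemma full_support_P: "full_support P"
  unfolding PiM_N[symmetric] using v_pos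
  by (intro full_support_PiM full_support_density_lborel data.product_prob_space_axioms)
     (simp_all add: normal_density_pos)

lemma measurable_P_continuous:
  fixes f :: "(nat \<times> nat \<Rightarrow> real) \<Rightarrow> 'a::topological_space"
  assumes "continuous_on UNIV f"
  shows "f \<in> borel_measurable P"
  using borel_measurable_continuous_onI[OF assms] measurable_cong_sets[OF sets_P_eq_borel refl] by blast

lemma measurable_coordinate [measurable]: "(\<lambda>w. w p) \<in> borel_measurable P"
  by (rule measurable_P_continuous) simp

lemma measurable_into_P:
  assumes "\<And>p. (\<lambda>x. f x p) \<in> borel_measurable M"
  shows "f \<in> M \<rightarrow>\<^sub>M P"
  using measurable_coordinatewise_then_product[of f M] assms
    measurable_cong_sets[OF refl sets_P_eq_borel] by blast

lemma measurable_fun_upd_P [measurable]: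
  assumes "f \<in> M \<rightarrow>\<^sub>M P" "g \<in> borel_measurable M"
  shows "(\<lambda>x. (f x)(p := g x)) \<in> M \<rightarrow>\<^sub>M P"
  using assms(2) measurable_compose[OF assms(1) measurable_coordinate]
  by (intro measurable_into_P) (simp add: fun_upd_def)

lemma distr_P_reindex:
  assumes "inj \<pi>"
  shows "distr P P (\<lambda>w. w \<circ> \<pi>) = P"
  using distr_PiM_reindex[of UNIV "\<lambda>_. N" \<pi> UNIV] assms prob_space_N
  by (simp add: PiM_N restrict_def comp_def)

end

section \<open>Stochastic gradient steps\<close>

abbreviation l2norm :: "nat \<Rightarrow> (nat \<Rightarrow> real) \<Rightarrow> real" where
  "l2norm d u \<equiv> L2_set u {..<d}"

definition basis_fun :: "nat \<Rightarrow> nat \<Rightarrow> real" where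
  "basis_fun j = (\<lambda>r. if r = j then 1 else 0)"

definition sgd_step :: "real \<Rightarrow> nat set \<Rightarrow> nat \<Rightarrow> (nat \<times> nat \<Rightarrow> real) \<Rightarrow> (nat \<Rightarrow> real) \<Rightarrow> nat \<Rightarrow> real" where
  "sgd_step \<kappa> I d w u = (\<lambda>p. u p - \<kappa> * (\<Sum>i\<in>I. w (i, p) * (\<Sum>q<d. w (i, q) * u q)))"

fun sgd_iter :: "real \<Rightarrow> nat \<Rightarrow> nat \<Rightarrow> (nat \<times> nat \<Rightarrow> real) \<Rightarrow> nat \<Rightarrow> (nat \<Rightarrow> real) \<Rightarrow> nat \<Rightarrow> real" where
  "sgd_iter \<kappa> b d w 0 u = u"
| "sgd_iter \<kappa> b d w (Suc k) u = sgd_step \<kappa> {b * k + 1 .. b * Suc k} d w (sgd_iter \<kappa> b d w k u)"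

definition step_norm :: "real \<Rightarrow> nat set \<Rightarrow> nat \<Rightarrow> (nat \<times> nat \<Rightarrow> real) \<Rightarrow> real" where
  "step_norm \<kappa> I d w = l2norm d (sgd_step \<kappa> I d w (basis_fun 0))"

lemma L2_set_cmult: "L2_set (\<lambda>i. t * f i) A = \<bar>t\<bar> * L2_set f A"
  by (simp add: L2_set_def power_mult_distrib real_sqrt_mult flip: sum_distrib_left)

lemma L2_set_sum_le: "L2_set (\<lambda>i. \<Sum>j\<in>J. f j i) A \<le> (\<Sum>j\<in>J. L2_set (f j) A)"
proof (induction J rule: infinite_finite_induct)
  case (insert j J)
  then show ?case using L2_set_triangle_ineq[of "f j" "\<lambda>i. \<Sum>j\<in>J. f j i" A] by simp
qed (simp_all add: L2_set_def)

lemma abs_le_L2_set: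
  assumes "finite A" "i \<in> A"
  shows "\<bar>f i\<bar> \<le> L2_set f A"
  using member_le_L2_set[OF assms, of "\<lambda>i. \<bar>f i\<bar>"] by (simp add: L2_set_def)

lemma continuous_on_L2_set [continuous_intros]:
  assumes "\<And>i. i \<in> A \<Longrightarrow> continuous_on S (\<lambda>x. f x i)"
  shows "continuous_on S (\<lambda>x. L2_set (f x) A)"
  unfolding L2_set_def using assms by (intro continuous_intros)

lemma basis_fun_same [simp]: "basis_fun j j = 1"
  by (simp add: basis_fun_def)

lemma l2norm_basis_fun: "j < d \<Longrightarrow> l2norm d (basis_fun j) = 1"
  by (simp add: L2_set_def basis_fun_def if_distrib[where f="\<lambda>x. x\<^sup>2"] sum.delta cong: if_cong)

lemma sgd_step_cmult: "sgd_step \<kappa> I d w (\<lambda>r. t * u r) = (\<lambda>r. t * sgd_step \<kappa> I d w u r)"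
  by (rule ext) (simp add: sgd_step_def algebra_simps sum_distrib_left)

lemma sgd_step_cong:
  assumes "\<And>r. r < d \<Longrightarrow> u r = u' r" "p < d" "\<And>i r. i \<in> I \<Longrightarrow> r < d \<Longrightarrow> w (i, r) = w' (i, r)"
  shows "sgd_step \<kappa> I d w u p = sgd_step \<kappa> I d w' u' p"
  using assms by (simp add: sgd_step_def)

lemma sgd_iter_cong:
  assumes "p < d" "\<And>i r. i \<le> b * k \<Longrightarrow> r < d \<Longrightarrow> w (i, r) = w' (i, r)"
  shows "sgd_iter \<kappa> b d w k u p = sgd_iter \<kappa> b d w' k u p"
  using assms
proof (induction k arbitrary: p)
  case (Suc k)
  have "b * k \<le> b * Suc k" by simp
  then show ?case
    using Suc.prems unfolding sgd_iter.simps
    by (intro sgd_step_cong Suc.IH) (auto intro: order_trans)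
qed simp

lemma sgd_step_basis_fun:
  assumes "d > 0"
  shows "sgd_step \<kappa> I d w (basis_fun 0) = (\<lambda>p. basis_fun 0 p - \<kappa> * (\<Sum>i\<in>I. w (i, 0) * w (i, p)))"
proof -
  have "(\<Sum>q<d. w (i, q) * basis_fun 0 q) = (\<Sum>q<d. if q = 0 then w (i, q) else 0)" for i
    by (intro sum.cong) (auto simp: basis_fun_def)
  then have "(\<Sum>q<d. w (i, q) * basis_fun 0 q) = w (i, 0)" for i
    using assms by simp
  then show ?thesis by (simp add: sgd_step_def mult.commute)
qed

lemma l2norm_sgd_step_first_axis:
  assumes d: "d > 0" and u: "\<And>r. 1 \<le> r \<Longrightarrow> r < d \<Longrightarrow> u r = 0"
  shows "l2norm d (sgd_step \<kappa> I d w u) = l2norm d u * step_norm \<kappa> I d w"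
proof -
  have axis: "u r = u 0 * basis_fun 0 r" if "r < d" for r
    using u[of r] that by (cases "r = 0") (auto simp: basis_fun_def)
  have "l2norm d u = l2norm d (\<lambda>r. u 0 * basis_fun 0 r)"
    by (rule L2_set_cong) (auto intro: axis)
  moreover have "l2norm d (sgd_step \<kappa> I d w u) = l2norm d (sgd_step \<kappa> I d w (\<lambda>r. u 0 * basis_fun 0 r))"
    by (intro L2_set_cong sgd_step_cong refl) (auto intro: axis)
  ultimately show ?thesis
    using d by (simp add: sgd_step_cmult L2_set_cmult l2norm_basis_fun step_norm_def)
qed

definition spike :: "nat \<Rightarrow> real \<Rightarrow> nat \<times> nat \<Rightarrow> real" where
  "spike a t = (\<lambda>p. if p = (a, 0) then t else 0)"

lemma step_norm_spike:
  assumes d: "d > 0" and I: "finite I"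
  shows "step_norm \<kappa> I d (spike a t) = (if a \<in> I then \<bar>1 - \<kappa> * t\<^sup>2\<bar> else 1)"
proof -
  have "(\<Sum>i\<in>I. spike a t (i, 0) * spike a t (i, p)) = (\<Sum>i\<in>I. if i = a then t\<^sup>2 * basis_fun 0 p else 0)" for p
    by (intro sum.cong) (auto simp: spike_def basis_fun_def power2_eq_square)
  then have "sgd_step \<kappa> I d (spike a t) (basis_fun 0)
      = (\<lambda>p. (if a \<in> I then 1 - \<kappa> * t\<^sup>2 else 1) * basis_fun 0 p)"
    using d I by (simp add: sgd_step_basis_fun fun_eq_iff algebra_simps)
  then show ?thesis
    using d unfolding step_norm_def by (simp only: L2_set_cmult) (simp add: l2norm_basis_fun)
qed

lemma continuous_on_sgd_step [continuous_intros]: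
  assumes "\<And>p. continuous_on S (\<lambda>x. f x p)" "\<And>r. continuous_on S (\<lambda>x. u x r)"
  shows "continuous_on S (\<lambda>x. sgd_step \<kappa> I d (f x) (u x) r)"
  unfolding sgd_step_def by (intro continuous_intros assms)

lemma continuous_on_sgd_iter [continuous_intros]: "continuous_on UNIV (\<lambda>w. sgd_iter \<kappa> b d w k u r)"
proof (induction k arbitrary: r)
  case (Suc k)
  then show ?case unfolding sgd_iter.simps by (intro continuous_on_sgd_step) simp_all
qed simp

lemma continuous_on_step_norm [continuous_intros]: "continuous_on UNIV (step_norm \<kappa> I d)"
  unfolding step_norm_def[abs_def] by (intro continuous_intros) simp

lemma step_norm_nonneg [simp]: "step_norm \<kappa> I d w \<ge> 0"
  by (simp add: step_norm_def)

section \<open>Rotation invariance of the stochastic gradient steps\<close>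

definition givens :: "real \<Rightarrow> real \<Rightarrow> nat \<Rightarrow> nat \<Rightarrow> (nat \<Rightarrow> real) \<Rightarrow> nat \<Rightarrow> real" where
  "givens c s p q u = u(p := c * u p - s * u q, q := s * u p + c * u q)"

definition givens_rows :: "real \<Rightarrow> real \<Rightarrow> nat \<Rightarrow> nat \<Rightarrow> nat set \<Rightarrow> (nat \<times> nat \<Rightarrow> real) \<Rightarrow> nat \<times> nat \<Rightarrow> real" where
  "givens_rows c s p q I w = (\<lambda>(i, r). if i \<in> I then givens c s p q (\<lambda>r. w (i, r)) r else w (i, r))"

lemma sum_mult_givens:
  assumes pq: "p \<noteq> q" "p < d" "q < d" and cs: "c\<^sup>2 + s\<^sup>2 = 1"
  shows "(\<Sum>r<d. givens c s p q u r * givens c s p q x r) = (\<Sum>r<d. u r * x r)"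
proof -
  have split: "(\<Sum>r<d. f r) = f p + (f q + (\<Sum>r\<in>{..<d} - {p} - {q}. f r))" for f :: "nat \<Rightarrow> real"
    using pq by (simp add: sum.remove[of "{..<d}" p] sum.remove[of "{..<d} - {p}" q])
  have rest: "(\<Sum>r\<in>{..<d} - {p} - {q}. givens c s p q u r * givens c s p q x r)
      = (\<Sum>r\<in>{..<d} - {p} - {q}. u r * x r)"
    by (intro sum.cong) (auto simp: givens_def)
  have "(c * u p - s * u q) * (c * x p - s * x q) + (s * u p + c * u q) * (s * x p + c * x q)
      = (c\<^sup>2 + s\<^sup>2) * (u p * x p + u q * x q)"
    by (simp add: power2_eq_square algebra_simps)
  then show ?thesis
    unfolding split rest using pq cs by (simp add: givens_def)
qed

lemma l2norm_givens:
  assumes "p \<noteq> q" "p < d" "q < d" "c\<^sup>2 + s\<^sup>2 = 1"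
  shows "l2norm d (givens c s p q u) = l2norm d u"
  using sum_mult_givens[OF assms, of u u] by (simp add: L2_set_def power2_eq_square)

lemma ex_givens_eq_0:
  assumes "u q \<noteq> 0"
  shows "\<exists>c s. c\<^sup>2 + s\<^sup>2 = 1 \<and> s \<noteq> 0 \<and> givens c s p q u q = 0"
proof -
  define \<rho> where "\<rho> = sqrt ((u p)\<^sup>2 + (u q)\<^sup>2)"
  have pos: "(u p)\<^sup>2 + (u q)\<^sup>2 > 0" using assms by (simp add: add_nonneg_pos)
  then have \<rho>: "\<rho> > 0" "\<rho>\<^sup>2 = (u p)\<^sup>2 + (u q)\<^sup>2" by (simp_all add: \<rho>_def)
  have "(u p / \<rho>)\<^sup>2 + (- u q / \<rho>)\<^sup>2 = 1"
    using \<rho>(2) assms by (simp add: power_divide add_divide_distrib[symmetric])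
  moreover have "- u q / \<rho> \<noteq> 0" using assms \<rho> by simp
  moreover have "givens (u p / \<rho>) (- u q / \<rho>) p q u q = 0" by (simp add: givens_def)
  ultimately show ?thesis by blast
qed

lemma sgd_step_givens:
  assumes pq: "p \<noteq> q" "p < d" "q < d" and cs: "c\<^sup>2 + s\<^sup>2 = 1"
  shows "sgd_step \<kappa> I d (givens_rows c s p q I w) (givens c s p q u) = givens c s p q (sgd_step \<kappa> I d w u)"
proof
  fix r
  let ?y = "\<lambda>i. \<Sum>r<d. w (i, r) * u r"
  have "(\<Sum>r<d. givens_rows c s p q I w (i, r) * givens c s p q u r) = ?y i" if "i \<in> I" for i
    using sum_mult_givens[OF assms, of "\<lambda>r. w (i, r)" u] that by (simp add: givens_rows_def)
  then have "sgd_step \<kappa> I d (givens_rows c s p q I w) (givens c s p q u) r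
      = givens c s p q u r - \<kappa> * (\<Sum>i\<in>I. givens c s p q (\<lambda>r. w (i, r)) r * ?y i)"
    by (simp add: sgd_step_def givens_rows_def)
  also have "\<dots> = givens c s p q (sgd_step \<kappa> I d w u) r"
    by (simp add: givens_def sgd_step_def left_diff_distrib distrib_right right_diff_distrib distrib_left
        sum.distrib sum_subtractf sum_distrib_left mult.assoc mult.left_commute)
  finally show "sgd_step \<kappa> I d (givens_rows c s p q I w) (givens c s p q u) r
      = givens c s p q (sgd_step \<kappa> I d w u) r" .
qed

context gaussian_data
begin

lemma measurable_sgd_step [measurable]: "(\<lambda>w. l2norm d (sgd_step \<kappa> I d w u)) \<in> borel_measurable P"
  by (intro measurable_P_continuous continuous_intros) simp

lemma measurable_sgd_iter [measurable]: "(\<lambda>w. l2norm d (sgd_iter \<kappa> b d w k u)) \<in> borel_measurable P"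
  by (intro measurable_P_continuous continuous_intros)

lemma measurable_step_norm [measurable]: "step_norm \<kappa> I d \<in> borel_measurable P"
  by (intro measurable_P_continuous continuous_intros)

lemma measurable_givens_rows [measurable]: "givens_rows c s p q I \<in> P \<rightarrow>\<^sub>M P"
proof (rule measurable_into_P)
  fix ir :: "nat \<times> nat"
  obtain i r where ir: "ir = (i, r)" by (cases ir)
  have "(\<lambda>w. givens c s p q (\<lambda>r. w (i, r)) r) \<in> borel_measurable P"
    by (simp add: givens_def fun_upd_def)
  then show "(\<lambda>w. givens_rows c s p q I w ir) \<in> borel_measurable P"
    by (cases "i \<in> I") (simp_all add: givens_rows_def ir)
qed

lemma distr_P_givens_row:
  assumes pq: "p \<noteq> q" and cs: "c\<^sup>2 + s\<^sup>2 = 1" "s \<noteq> 0"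
  shows "distr P P (givens_rows c s p q {i}) = P"
proof (rule measure_eqI_nn_integral)
  fix f :: "_ \<Rightarrow> ennreal" assume f [measurable]: "f \<in> borel_measurable P"
  let ?upd = "\<lambda>w x y. w((i, p) := x, (i, q) := y)"
  have resample: "(\<integral>\<^sup>+w. g w \<partial>P) = (\<integral>\<^sup>+w. \<integral>\<^sup>+x. \<integral>\<^sup>+y. g (?upd w x y) \<partial>N \<partial>N \<partial>P)"
    if [measurable]: "g \<in> borel_measurable P" for g :: "_ \<Rightarrow> ennreal"
    by (subst data.nn_integral_PiM_fun_upd[of _ "(i, q)"], measurable,
        subst data.nn_integral_PiM_fun_upd[of _ "(i, p)"]) measurable
  have givens: "givens_rows c s p q {i} (?upd w x y) = ?upd w (c * x - s * y) (s * x + c * y)" for w x y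
    using pq by (auto simp: givens_rows_def givens_def fun_eq_iff)
  have "(\<integral>\<^sup>+w. f w \<partial>distr P P (givens_rows c s p q {i})) = (\<integral>\<^sup>+w. f (givens_rows c s p q {i} w) \<partial>P)"
    by (rule nn_integral_distr) simp_all
  also have "\<dots> = (\<integral>\<^sup>+w. \<integral>\<^sup>+x. \<integral>\<^sup>+y. f (?upd w (c * x - s * y) (s * x + c * y)) \<partial>N \<partial>N \<partial>P)"
    unfolding givens[symmetric] by (rule resample) measurable
  also have "\<dots> = (\<integral>\<^sup>+w. \<integral>\<^sup>+x. \<integral>\<^sup>+y. f (?upd w x y) \<partial>N \<partial>N \<partial>P)"
  proof (rule nn_integral_cong)
    fix w
    have "(\<lambda>(x, y). f (?upd w x y)) \<in> borel_measurable (borel \<Otimes>\<^sub>M borel)" by measurable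
    from nn_integral_normal_rotate[OF this cs]
    show "(\<integral>\<^sup>+x. \<integral>\<^sup>+y. f (?upd w (c * x - s * y) (s * x + c * y)) \<partial>N \<partial>N)
        = (\<integral>\<^sup>+x. \<integral>\<^sup>+y. f (?upd w x y) \<partial>N \<partial>N)" .
  qed
  also have "\<dots> = (\<integral>\<^sup>+w. f w \<partial>P)"
    by (rule resample[symmetric]) simp
  finally show "(\<integral>\<^sup>+w. f w \<partial>distr P P (givens_rows c s p q {i})) = (\<integral>\<^sup>+w. f w \<partial>P)" .
qed simp

lemma distr_P_givens_rows:
  assumes "finite I" and pq: "p \<noteq> q" and cs: "c\<^sup>2 + s\<^sup>2 = 1" "s \<noteq> 0"
  shows "distr P P (givens_rows c s p q I) = P"
  using assms(1)
proof (induction I)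
  case empty
  show ?case by (simp add: givens_rows_def[abs_def] case_prod_eta)
next
  case (insert i I)
  have "givens_rows c s p q (insert i I) = givens_rows c s p q {i} \<circ> givens_rows c s p q I"
    using insert.hyps by (auto simp: givens_rows_def givens_def fun_eq_iff)
  then have "distr P P (givens_rows c s p q (insert i I))
      = distr (distr P P (givens_rows c s p q I)) P (givens_rows c s p q {i})"
    by (simp add: distr_distr)
  then show ?case
    by (simp add: insert.IH distr_P_givens_row[OF pq cs])
qed

lemma distr_l2norm_sgd_step_givens:
  assumes I: "finite I" and pq: "p \<noteq> q" "p < d" "q < d" and cs: "c\<^sup>2 + s\<^sup>2 = 1" "s \<noteq> 0"
  shows "distr P borel (\<lambda>w. l2norm d (sgd_step \<kappa> I d w (givens c s p q u)))
       = distr P borel (\<lambda>w. l2norm d (sgd_step \<kappa> I d w u))"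
proof -
  have "distr P borel (\<lambda>w. l2norm d (sgd_step \<kappa> I d w (givens c s p q u)))
      = distr (distr P P (givens_rows c s p q I)) borel (\<lambda>w. l2norm d (sgd_step \<kappa> I d w (givens c s p q u)))"
    by (simp only: distr_P_givens_rows[OF I pq(1) cs])
  also have "\<dots> = distr P borel (\<lambda>w. l2norm d (sgd_step \<kappa> I d w u))"
    by (simp add: distr_distr comp_def sgd_step_givens[OF pq cs(1)] l2norm_givens[OF pq cs(1)])
  finally show ?thesis .
qed

text \<open>A Givens rotation in the coordinates 0 and n kills the n-th coordinate of u without
  changing the law of the step, so u can be moved onto the first axis.\<close>

lemma distr_l2norm_sgd_step:
  assumes I: "finite I" and d: "d > 0"
  shows "distr P borel (\<lambda>w. l2norm d (sgd_step \<kappa> I d w u)) = distr P borel (\<lambda>w. l2norm d u * step_norm \<kappa> I d w)"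
proof -
  have "distr P borel (\<lambda>w. l2norm d (sgd_step \<kappa> I d w u)) = distr P borel (\<lambda>w. l2norm d u * step_norm \<kappa> I d w)"
    if "1 \<le> n" "\<And>r. n \<le> r \<Longrightarrow> r < d \<Longrightarrow> u r = 0" for n
    using that
  proof (induction n arbitrary: u rule: nat_induct_at_least)
    case base
    then show ?case by (simp add: l2norm_sgd_step_first_axis[OF d])
  next
    case (Suc n)
    show ?case
    proof (cases "n < d \<and> u n \<noteq> 0")
      case False
      then have "u r = 0" if "n \<le> r" "r < d" for r
        using that Suc.prems[of r] by (cases "r = n") auto
      then show ?thesis by (rule Suc.IH)
    next
      case True
      have n: "0 \<noteq> n" "0 < d" "n < d" using True d Suc.hyps by auto
      obtain c s where cs: "c\<^sup>2 + s\<^sup>2 = 1" "s \<noteq> 0" "givens c s 0 n u n = 0"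
        using ex_givens_eq_0[of u n 0] True by blast
      have "givens c s 0 n u r = 0" if "n \<le> r" "r < d" for r
        using that n Suc.prems[of r] cs(3) by (auto simp: givens_def)
      then have "distr P borel (\<lambda>w. l2norm d (sgd_step \<kappa> I d w (givens c s 0 n u)))
          = distr P borel (\<lambda>w. l2norm d (givens c s 0 n u) * step_norm \<kappa> I d w)"
        by (rule Suc.IH)
      then show ?thesis
        by (simp add: distr_l2norm_sgd_step_givens[OF I n cs(1,2)] l2norm_givens[OF n cs(1)])
    qed
  qed
  from this[of d] show ?thesis using d by simp
qed

lemma nn_integral_sgd_step_powr:
  assumes "finite I" "d > 0"
  shows "(\<integral>\<^sup>+w. ennreal (l2norm d (sgd_step \<kappa> I d w u) powr s) \<partial>P)
       = ennreal (l2norm d u powr s) * (\<integral>\<^sup>+w. ennreal (step_norm \<kappa> I d w powr s) \<partial>P)"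
proof -
  have "(\<integral>\<^sup>+w. ennreal (l2norm d (sgd_step \<kappa> I d w u) powr s) \<partial>P)
      = (\<integral>\<^sup>+r. ennreal (r powr s) \<partial>distr P borel (\<lambda>w. l2norm d (sgd_step \<kappa> I d w u)))"
    by (simp add: nn_integral_distr)
  also have "\<dots> = (\<integral>\<^sup>+w. ennreal ((l2norm d u * step_norm \<kappa> I d w) powr s) \<partial>P)"
    unfolding distr_l2norm_sgd_step[OF assms] by (simp add: nn_integral_distr)
  also have "\<dots> = ennreal (l2norm d u powr s) * (\<integral>\<^sup>+w. ennreal (step_norm \<kappa> I d w powr s) \<partial>P)"
    by (simp add: powr_mult ennreal_mult' nn_integral_cmult)
  finally show ?thesis .
qed

lemma distr_step_norm_reindex:
  assumes \<pi>: "inj \<pi>"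
  shows "distr P borel (step_norm \<kappa> (\<pi> ` I) d) = distr P borel (step_norm \<kappa> I d)"
proof -
  define \<phi> where "\<phi> = (\<lambda>(i, r :: nat). (\<pi> i, r))"
  have inj: "inj \<phi>" using \<pi> by (auto simp: inj_on_def \<phi>_def)
  have reindex: "step_norm \<kappa> (\<pi> ` I) d = step_norm \<kappa> I d \<circ> (\<lambda>w. w \<circ> \<phi>)"
    using \<pi> by (auto simp: step_norm_def sgd_step_def \<phi>_def sum.reindex inj_on_subset comp_def fun_eq_iff)
  have "(\<lambda>w. w \<circ> \<phi>) \<in> P \<rightarrow>\<^sub>M P"
    by (rule measurable_into_P) simp
  then have "distr P borel (step_norm \<kappa> (\<pi> ` I) d) = distr (distr P P (\<lambda>w. w \<circ> \<phi>)) borel (step_norm \<kappa> I d)"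
    unfolding reindex by (simp add: distr_distr)
  then show ?thesis by (simp add: distr_P_reindex[OF inj])
qed

lemma distr_step_norm_card:
  assumes fin: "finite I" "finite I'" and card: "card I = card I'"
  shows "distr P borel (step_norm \<kappa> I d) = distr P borel (step_norm \<kappa> I' d)"
proof -
  obtain h where h: "bij_betw h I I'"
    using finite_same_card_bij[OF fin card] by blast
  obtain n where n: "I' \<subseteq> {..<n}"
    using finite_nat_bounded[OF fin(2)] by blast
  define \<pi> where "\<pi> i = (if i \<in> I then h i else i + n)" for i
  have h_less: "h i < n" if "i \<in> I" for i
    using bij_betwE[OF h] that n by blast
  have "inj \<pi>"
  proof (rule injI)
    fix i j assume "\<pi> i = \<pi> j"
    then show "i = j"
      using h_less[of i] h_less[of j] inj_onD[OF bij_betw_imp_inj_on[OF h], of i j]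
      by (cases "i \<in> I"; cases "j \<in> I") (simp_all add: \<pi>_def)
  qed
  moreover have "\<pi> ` I = I'"
    using bij_betw_imp_surj_on[OF h] by (simp add: \<pi>_def cong: image_cong)
  ultimately show ?thesis
    using distr_step_norm_reindex[of \<pi> \<kappa> I d] by simp
qed

lemma nn_integral_step_norm_powr_card:
  assumes "finite I" "finite I'" "card I = card I'"
  shows "(\<integral>\<^sup>+w. ennreal (step_norm \<kappa> I d w powr s) \<partial>P) = (\<integral>\<^sup>+w. ennreal (step_norm \<kappa> I' d w powr s) \<partial>P)"
  using nn_integral_distr[of "step_norm \<kappa> I d" P borel "\<lambda>r. ennreal (r powr s)"]
    nn_integral_distr[of "step_norm \<kappa> I' d" P borel "\<lambda>r. ennreal (r powr s)"] distr_step_norm_card[OF assms]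
  by simp

text \<open>The identity holds for every real s, also negative, because 0 powr s = 0.\<close>

lemma nn_integral_sgd_iter_powr:
  assumes d: "d > 0"
  shows "(\<integral>\<^sup>+w. ennreal (l2norm d (sgd_iter \<kappa> b d w k u) powr s) \<partial>P)
       = ennreal (l2norm d u powr s) * (\<integral>\<^sup>+w. ennreal (step_norm \<kappa> {..<b} d w powr s) \<partial>P) ^ k"
proof (induction k)
  case 0
  then show ?case by (simp add: data.emeasure_space_1[simplified])
next
  case (Suc k)
  define J :: "(nat \<times> nat) set" where "J = {..b * k} \<times> UNIV"
  let ?I = "{b * k + 1 .. b * Suc k}"
  let ?m = "\<integral>\<^sup>+w. ennreal (step_norm \<kappa> {..<b} d w powr s) \<partial>P"
  have block: "(\<integral>\<^sup>+w. ennreal (step_norm \<kappa> ?I d w powr s) \<partial>P) = ?m"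
    by (intro nn_integral_step_norm_powr_card) auto
  have "l2norm d (sgd_iter \<kappa> b d (merge J (- J) (w, w')) (Suc k) u)
      = l2norm d (sgd_step \<kappa> ?I d w' (sgd_iter \<kappa> b d w k u))" for w w'
    unfolding sgd_iter.simps
    by (intro L2_set_cong sgd_step_cong sgd_iter_cong) (auto simp: merge_def J_def)
  then have "(\<integral>\<^sup>+w. ennreal (l2norm d (sgd_iter \<kappa> b d w (Suc k) u) powr s) \<partial>P)
      = (\<integral>\<^sup>+w. \<integral>\<^sup>+w'. ennreal (l2norm d (sgd_step \<kappa> ?I d w' (sgd_iter \<kappa> b d w k u)) powr s) \<partial>P \<partial>P)"
    using data.nn_integral_PiM_merge[of "\<lambda>w. ennreal (l2norm d (sgd_iter \<kappa> b d w (Suc k) u) powr s)" J]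
    by (simp add: Compl_eq_Diff_UNIV[symmetric] del: sgd_iter.simps mult_Suc_right)
  also have "\<dots> = (\<integral>\<^sup>+w. ennreal (l2norm d (sgd_iter \<kappa> b d w k u) powr s) * ?m \<partial>P)"
    using d block by (simp add: nn_integral_sgd_step_powr del: mult_Suc_right)
  also have "\<dots> = (\<integral>\<^sup>+w. ennreal (l2norm d (sgd_iter \<kappa> b d w k u) powr s) \<partial>P) * ?m"
    by (rule nn_integral_multc) simp
  finally show ?case
    by (simp add: Suc.IH mult.left_commute mult.commute)
qed

end

section \<open>Moments of a single step\<close>

lemma step_norm_ge:
  assumes "d > 0"
  shows "\<bar>1 - \<kappa> * (\<Sum>i\<in>I. (w (i, 0))\<^sup>2)\<bar> \<le> step_norm \<kappa> I d w"
  using abs_le_L2_set[of "{..<d}" 0 "sgd_step \<kappa> I d w (basis_fun 0)"] assms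
  by (simp add: step_norm_def sgd_step_basis_fun power2_eq_square)

lemma step_norm_le:
  assumes d: "d > 0" and \<kappa>: "\<kappa> \<ge> 0"
  shows "step_norm \<kappa> I d w \<le> 1 + \<kappa> * (\<Sum>i\<in>I. \<Sum>p<d. (w (i, p))\<^sup>2)"
proof -
  let ?row = "\<lambda>i p. w (i, p)"
  have row: "\<bar>w (i, 0)\<bar> * l2norm d (?row i) \<le> (\<Sum>p<d. (w (i, p))\<^sup>2)" for i
  proof -
    have "\<bar>w (i, 0)\<bar> * l2norm d (?row i) \<le> l2norm d (?row i) * l2norm d (?row i)"
      using d abs_le_L2_set[of "{..<d}" 0 "?row i"] by (intro mult_right_mono) auto
    then show ?thesis by (simp add: L2_set_def sum_nonneg)
  qed
  have "step_norm \<kappa> I d w = l2norm d (\<lambda>p. basis_fun 0 p + (- \<kappa>) * (\<Sum>i\<in>I. w (i, 0) * w (i, p)))"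
    using d by (simp add: step_norm_def sgd_step_basis_fun)
  also have "\<dots> \<le> l2norm d (basis_fun 0) + l2norm d (\<lambda>p. (- \<kappa>) * (\<Sum>i\<in>I. w (i, 0) * w (i, p)))"
    by (rule L2_set_triangle_ineq)
  also have "\<dots> = 1 + \<kappa> * l2norm d (\<lambda>p. \<Sum>i\<in>I. w (i, 0) * w (i, p))"
    unfolding L2_set_cmult using d \<kappa> by (simp add: l2norm_basis_fun)
  also have "\<dots> \<le> 1 + \<kappa> * (\<Sum>i\<in>I. \<bar>w (i, 0)\<bar> * l2norm d (?row i))"
    using L2_set_sum_le[of "\<lambda>i p. w (i, 0) * w (i, p)" I "{..<d}"] \<kappa>
    by (simp add: L2_set_cmult mult_left_mono)
  also have "\<dots> \<le> 1 + \<kappa> * (\<Sum>i\<in>I. \<Sum>p<d. (w (i, p))\<^sup>2)"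
    using \<kappa> by (intro add_left_mono mult_left_mono sum_mono row)
  finally show ?thesis .
qed

lemma add_one_powr_le_exp:
  fixes s x L \<delta> :: real
  assumes "s > 0" "x \<ge> 0" "L \<ge> 0" "\<delta> > 0"
  shows "(1 + L * x) powr s \<le> (max 1 (L * s / \<delta>)) powr s * exp (\<delta> * x)"
proof -
  define K where "K = max 1 (L * s / \<delta>)"
  have K: "K \<ge> 1" "L * s / \<delta> \<le> K" by (auto simp: K_def)
  have "L \<le> K * (\<delta> / s)" using K(2) assms by (simp add: field_simps)
  then have "L * x \<le> K * (\<delta> / s) * x" using assms by (intro mult_right_mono) auto
  then have "1 + L * x \<le> K * (1 + \<delta> * x / s)" using K(1) by (simp add: algebra_simps)
  also have "\<dots> \<le> K * exp (\<delta> * x / s)"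
    using K(1) by (intro mult_left_mono exp_ge_add_one_self) auto
  finally have "(1 + L * x) powr s \<le> (K * exp (\<delta> * x / s)) powr s"
    using assms by (intro powr_mono2) auto
  also have "\<dots> = K powr s * exp (\<delta> * x)"
    using K(1) assms by (simp add: powr_mult) (simp add: powr_def)
  finally show ?thesis by (simp add: K_def)
qed

lemma nn_integral_normal_exp_square:
  assumes "\<sigma> > 0"
  shows "(\<integral>\<^sup>+x. ennreal (exp (x\<^sup>2 / (4 * \<sigma>\<^sup>2))) \<partial>density lborel (normal_density 0 \<sigma>)) = ennreal (sqrt 2)"
proof -
  interpret wide: prob_space "density lborel (normal_density 0 (sqrt 2 * \<sigma>))"
    using assms by (intro prob_space_normal_density) simp
  have "normal_density 0 \<sigma> x * exp (x\<^sup>2 / (4 * \<sigma>\<^sup>2)) = sqrt 2 * normal_density 0 (sqrt 2 * \<sigma>) x" for x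
  proof -
    have "- (x\<^sup>2 / (2 * \<sigma>\<^sup>2)) + x\<^sup>2 / (4 * \<sigma>\<^sup>2) = - (x\<^sup>2 / (4 * \<sigma>\<^sup>2))"
      using assms by (simp add: field_simps)
    then have "exp (- (x\<^sup>2 / (2 * \<sigma>\<^sup>2))) * exp (x\<^sup>2 / (4 * \<sigma>\<^sup>2)) = exp (- (x\<^sup>2 / (4 * \<sigma>\<^sup>2)))"
      by (simp add: exp_add[symmetric])
    then show ?thesis
      using assms by (simp add: normal_density_def real_sqrt_mult power_mult_distrib field_simps)
  qed
  then have "(\<integral>\<^sup>+x. ennreal (exp (x\<^sup>2 / (4 * \<sigma>\<^sup>2))) \<partial>density lborel (normal_density 0 \<sigma>))
      = (\<integral>\<^sup>+x. ennreal (sqrt 2) * ennreal (normal_density 0 (sqrt 2 * \<sigma>) x) \<partial>lborel)"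
    by (simp add: nn_integral_density ennreal_mult'[symmetric])
  also have "\<dots> = ennreal (sqrt 2)"
    using wide.emeasure_space_1 by (simp add: nn_integral_cmult emeasure_density)
  finally show ?thesis .
qed

lemma nn_integral_unit_interval_powr:
  fixes a :: real
  assumes "- 1 < a"
  shows "(\<integral>\<^sup>+y. ennreal (indicator {0..1} y * y powr a) \<partial>lborel) = ennreal (1 / (a + 1))"
  using nn_integral_has_integral_lebesgue[OF _ has_integral_powr_from_0[of a 1]] assms by simp

lemma abs_powr_le_add_unit_interval:
  fixes a y :: real
  assumes "a \<le> 0"
  shows "\<bar>y\<bar> powr a \<le> 1 + (indicator {0..1} y * y powr a + indicator {0..1} (- y) * (- y) powr a)"
proof (cases "\<bar>y\<bar> \<le> 1")
  case True
  then show ?thesis by (cases "y \<ge> 0") (auto simp: indicator_def)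
next
  case False
  then have "\<bar>y\<bar> powr a \<le> \<bar>y\<bar> powr 0" using assms by (intro powr_mono) auto
  then show ?thesis using False by (cases "y = 0") (auto simp: indicator_def)
qed

lemma ex_nn_integral_abs_powr_bound:
  fixes f :: "real \<Rightarrow> real"
  assumes [measurable]: "f \<in> borel_measurable borel" and f: "\<And>x. 0 \<le> f x" "\<And>x. f x \<le> B"
    and "prob_space (density lborel f)" and a: "- 1 < a" "a \<le> 0"
  shows "\<exists>K<\<infinity>. \<forall>r. (\<integral>\<^sup>+x. ennreal (\<bar>x - r\<bar> powr a) \<partial>density lborel f) \<le> K"
proof -
  interpret prob_space "density lborel f" by fact
  define g where "g y = ennreal (indicator {0..1} y * y powr a)" for y :: real
  have [measurable]: "g \<in> borel_measurable borel" unfolding g_def by measurable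
  have "(\<integral>\<^sup>+x. ennreal (\<bar>x - r\<bar> powr a) \<partial>density lborel f) \<le> 1 + ennreal B * ennreal (2 / (a + 1))" for r
  proof -
    have translate: "(\<integral>\<^sup>+x. g (x - r) \<partial>lborel) = ennreal (1 / (a + 1))"
      "(\<integral>\<^sup>+x. g (r - x) \<partial>lborel) = ennreal (1 / (a + 1))"
      using nn_integral_real_affine[of g 1 "- r"] nn_integral_real_affine[of g "-1" r]
        nn_integral_unit_interval_powr[OF a(1)] by (simp_all add: g_def)
    have "ennreal (\<bar>x - r\<bar> powr a) \<le> 1 + (g (x - r) + g (r - x))" for x
      using ennreal_leI[OF abs_powr_le_add_unit_interval[OF a(2), of "x - r"]] by (simp add: g_def)
    then have "(\<integral>\<^sup>+x. ennreal (\<bar>x - r\<bar> powr a) \<partial>density lborel f)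
        \<le> (\<integral>\<^sup>+x. 1 + (g (x - r) + g (r - x)) \<partial>density lborel f)"
      by (intro nn_integral_mono)
    also have "\<dots> = 1 + (\<integral>\<^sup>+x. ennreal (f x) * (g (x - r) + g (r - x)) \<partial>lborel)"
      by (subst nn_integral_add) (simp_all add: emeasure_space_1[simplified] nn_integral_density)
    also have "\<dots> \<le> 1 + (\<integral>\<^sup>+x. ennreal B * (g (x - r) + g (r - x)) \<partial>lborel)"
      using f by (intro add_left_mono nn_integral_mono mult_right_mono ennreal_leI) auto
    also have "\<dots> = 1 + ennreal B * ennreal (2 / (a + 1))"
      using a by (simp add: nn_integral_cmult nn_integral_add translate ennreal_plus[symmetric] del: ennreal_plus)
    finally show ?thesis .
  qed
  moreover have "1 + ennreal B * ennreal (2 / (a + 1)) < \<infinity>"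
    by (simp add: ennreal_mult_less_top)
  ultimately show ?thesis by blast
qed

lemma power2_diff_sqrt_le:
  fixes D x :: real
  shows "(\<bar>x\<bar> - sqrt (max D 0))\<^sup>2 \<le> \<bar>D - x\<^sup>2\<bar>"
proof (cases "D \<ge> 0")
  case True
  define r where "r = sqrt D"
  have r: "r \<ge> 0" "D = r\<^sup>2" using True by (simp_all add: r_def)
  have "(\<bar>x\<bar> - r)\<^sup>2 = \<bar>\<bar>x\<bar> - r\<bar> * \<bar>\<bar>x\<bar> - r\<bar>" by (simp add: power2_eq_square)
  also have "\<dots> \<le> \<bar>\<bar>x\<bar> - r\<bar> * (\<bar>x\<bar> + r)"
    using r by (intro mult_left_mono) auto
  also have "\<dots> = \<bar>(\<bar>x\<bar> - r) * (\<bar>x\<bar> + r)\<bar>"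
    using r by (simp add: abs_mult)
  also have "\<dots> = \<bar>D - x\<^sup>2\<bar>"
    by (simp add: r(2) power2_eq_square algebra_simps abs_minus_commute)
  finally show ?thesis using True by (simp add: r_def max_def)
next
  case False
  then show ?thesis by (simp add: max_def)
qed

lemma abs_diff_power2_powr_le:
  fixes D x s :: real
  defines "r \<equiv> sqrt (max D 0)"
  assumes "\<bar>x\<bar> \<noteq> r" and "s \<le> 0"
  shows "\<bar>D - x\<^sup>2\<bar> powr s \<le> \<bar>x - r\<bar> powr (2 * s) + \<bar>x + r\<bar> powr (2 * s)"
proof -
  have "\<bar>D - x\<^sup>2\<bar> powr s \<le> ((\<bar>x\<bar> - r)\<^sup>2) powr s"
    using assms power2_diff_sqrt_le[of x D] by (intro powr_mono2') auto
  also have "(\<bar>x\<bar> - r)\<^sup>2 = \<bar>\<bar>x\<bar> - r\<bar> powr 2" by simp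
  also have "(\<bar>\<bar>x\<bar> - r\<bar> powr 2) powr s = \<bar>\<bar>x\<bar> - r\<bar> powr (2 * s)" by (rule powr_powr)
  also have "\<dots> \<le> \<bar>x - r\<bar> powr (2 * s) + \<bar>x + r\<bar> powr (2 * s)"
    by (cases "x \<ge> 0") (simp_all add: abs_minus_commute[of "- x" r] add.commute)
  finally show ?thesis .
qed

lemma step_norm_fun_upd_ge:
  assumes "d > 0" "finite I" "a \<in> I" "\<kappa> > 0"
  shows "\<kappa> * \<bar>(1 / \<kappa> - (\<Sum>i\<in>I - {a}. (w (i, 0))\<^sup>2)) - x\<^sup>2\<bar> \<le> step_norm \<kappa> I d (w((a, 0) := x))"
proof -
  let ?D = "1 / \<kappa> - (\<Sum>i\<in>I - {a}. (w (i, 0))\<^sup>2)"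
  have "(\<Sum>i\<in>I. ((w((a, 0) := x)) (i, 0))\<^sup>2) = x\<^sup>2 + (\<Sum>i\<in>I - {a}. (w (i, 0))\<^sup>2)"
    using assms(2,3) by (subst sum.remove[of I a]) (auto intro!: sum.cong)
  then have "\<kappa> * (?D - x\<^sup>2) = 1 - \<kappa> * (\<Sum>i\<in>I. ((w((a, 0) := x)) (i, 0))\<^sup>2)"
    using assms(4) by (simp add: right_diff_distrib distrib_left)
  then have "\<kappa> * \<bar>?D - x\<^sup>2\<bar> = \<bar>1 - \<kappa> * (\<Sum>i\<in>I. ((w((a, 0) := x)) (i, 0))\<^sup>2)\<bar>"
    using assms(4) by (metis abs_mult abs_of_pos)
  then show ?thesis
    using step_norm_ge[OF assms(1), of \<kappa> "w((a, 0) := x)" I] by simp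
qed

context gaussian_data
begin

lemma AE_N_abs_neq: "AE x in N. \<bar>x\<bar> \<noteq> r"
proof -
  have "AE x in lborel. x \<notin> {r, - r}"
    by (intro AE_not_in finite_imp_null_set_lborel) simp
  then have "AE x in lborel. 0 < ennreal (normal_density 0 (sqrt v) x) \<longrightarrow> x \<notin> {r, - r}"
    by eventually_elim simp
  then have "AE x in N. x \<notin> {r, - r}"
    by (subst AE_density) simp_all
  then show ?thesis
    by eventually_elim auto
qed

lemma AE_step_norm_pos:
  assumes d: "d > 0" and I: "finite I" "I \<noteq> {}" and \<kappa>: "\<kappa> > 0"
  shows "AE w in P. step_norm \<kappa> I d w > 0"
proof -
  obtain a where a: "a \<in> I" using I by auto
  show ?thesis
  proof (rule data.AE_PiM_fun_updI[where i = "(a, 0)"])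
    fix w :: "nat \<times> nat \<Rightarrow> real"
    define D where "D = 1 / \<kappa> - (\<Sum>i\<in>I - {a}. (w (i, 0))\<^sup>2)"
    have "AE x in N. \<bar>x\<bar> \<noteq> sqrt (max D 0)" by (rule AE_N_abs_neq)
    then show "AE x in N. step_norm \<kappa> I d (w((a, 0) := x)) > 0"
    proof eventually_elim
      case (elim x)
      then have "D \<noteq> x\<^sup>2" by auto
      then have "0 < \<kappa> * \<bar>D - x\<^sup>2\<bar>" using \<kappa> by simp
      then show ?case
        using step_norm_fun_upd_ge[OF d I(1) a \<kappa>, of w x] by (simp add: D_def)
    qed
  qed simp_all
qed

lemma integrable_step_norm_powr_pos:
  assumes d: "d > 0" and I: "finite I" and \<kappa>: "\<kappa> > 0" and s: "s > 0"
  shows "integrable P (\<lambda>w. step_norm \<kappa> I d w powr s)"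
proof (intro integrableI_bounded)
  define J where "J = I \<times> {..<d}"
  define K where "K = max 1 (\<kappa> * s / (1 / (4 * v)))"
  have J: "finite J" using I by (simp add: J_def)
  have "step_norm \<kappa> I d w powr s \<le> K powr s * (\<Prod>j\<in>J. exp ((w j)\<^sup>2 / (4 * v)))" for w
  proof -
    have "step_norm \<kappa> I d w \<le> 1 + \<kappa> * (\<Sum>j\<in>J. (w j)\<^sup>2)"
      using step_norm_le[OF d, of \<kappa> I w] \<kappa> by (simp add: J_def sum.cartesian_product case_prod_beta')
    then have "step_norm \<kappa> I d w powr s \<le> (1 + \<kappa> * (\<Sum>j\<in>J. (w j)\<^sup>2)) powr s"
      using s by (intro powr_mono2) auto
    also have "\<dots> \<le> K powr s * exp (1 / (4 * v) * (\<Sum>j\<in>J. (w j)\<^sup>2))"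
      unfolding K_def using s \<kappa> v_pos by (intro add_one_powr_le_exp) (auto intro: sum_nonneg)
    also have "exp (1 / (4 * v) * (\<Sum>j\<in>J. (w j)\<^sup>2)) = (\<Prod>j\<in>J. exp ((w j)\<^sup>2 / (4 * v)))"
      using J by (simp add: exp_sum[symmetric] sum_divide_distrib)
    finally show ?thesis .
  qed
  then have "(\<integral>\<^sup>+w. ennreal (norm (step_norm \<kappa> I d w powr s)) \<partial>P)
      \<le> (\<integral>\<^sup>+w. ennreal (K powr s) * (\<Prod>j\<in>J. ennreal (exp ((w j)\<^sup>2 / (4 * v)))) \<partial>P)"
    by (intro nn_integral_mono) (simp add: prod_ennreal ennreal_mult'[symmetric] prod_nonneg ennreal_leI)
  also have "\<dots> = ennreal (K powr s) * (\<Prod>j\<in>J. ennreal (sqrt 2))"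
    using J v_pos nn_integral_normal_exp_square[of "sqrt v"]
    by (simp add: nn_integral_cmult data.nn_integral_PiM_prod[where f = "\<lambda>_ x. ennreal (exp (x\<^sup>2 / (4 * v)))"])
  also have "\<dots> < \<infinity>" by (simp add: ennreal_power ennreal_mult_less_top)
  finally show "(\<integral>\<^sup>+w. ennreal (norm (step_norm \<kappa> I d w powr s)) \<partial>P) < \<infinity>" .
qed measurable

text \<open>As a function of one Gaussian coordinate x the norm is at least \<open>\<kappa> \<bar>D - x\<^sup>2\<bar>\<close>,
  where D depends on the other coordinates; the bound below is uniform in D.\<close>

lemma ex_nn_integral_step_norm_fun_upd_bound:
  assumes d: "d > 0" and I: "finite I" "a \<in> I" and \<kappa>: "\<kappa> > 0" and s: "- (1/2) < s" "s \<le> 0"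
  shows "\<exists>K<\<infinity>. \<forall>w. (\<integral>\<^sup>+x. ennreal (step_norm \<kappa> I d (w((a, 0) := x)) powr s) \<partial>N) \<le> K"
proof -
  have density_bound: "normal_density 0 (sqrt v) x \<le> 1 / sqrt (2 * pi * v)" for x
    using v_pos by (simp add: normal_density_def divide_right_mono)
  obtain K where K_finite: "K < \<infinity>" and K: "\<And>r. (\<integral>\<^sup>+x. ennreal (\<bar>x - r\<bar> powr (2 * s)) \<partial>N) \<le> K"
    using ex_nn_integral_abs_powr_bound[OF _ _ density_bound prob_space_N, of "2 * s"] s by auto
  have "(\<integral>\<^sup>+x. ennreal (step_norm \<kappa> I d (w((a, 0) := x)) powr s) \<partial>N) \<le> ennreal (\<kappa> powr s) * (K + K)" for w
  proof -
    define D where "D = 1 / \<kappa> - (\<Sum>i\<in>I - {a}. (w (i, 0))\<^sup>2)"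
    define r where "r = sqrt (max D 0)"
    have "AE x in N. \<bar>x\<bar> \<noteq> r" by (rule AE_N_abs_neq)
    then have "AE x in N. ennreal (step_norm \<kappa> I d (w((a, 0) := x)) powr s)
        \<le> ennreal (\<kappa> powr s) * (ennreal (\<bar>x - r\<bar> powr (2 * s)) + ennreal (\<bar>x - (- r)\<bar> powr (2 * s)))"
    proof eventually_elim
      case (elim x)
      then have "D \<noteq> x\<^sup>2" by (auto simp: r_def)
      then have "step_norm \<kappa> I d (w((a, 0) := x)) powr s \<le> (\<kappa> * \<bar>D - x\<^sup>2\<bar>) powr s"
        using step_norm_fun_upd_ge[OF d I \<kappa>, of w x] s \<kappa> unfolding D_def by (intro powr_mono2') auto
      also have "\<dots> \<le> \<kappa> powr s * (\<bar>x - r\<bar> powr (2 * s) + \<bar>x + r\<bar> powr (2 * s))"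
        using elim s \<kappa> unfolding r_def by (simp add: powr_mult mult_left_mono abs_diff_power2_powr_le)
      finally show ?case
        by (simp add: ennreal_mult'[symmetric] ennreal_plus[symmetric] ennreal_leI del: ennreal_plus)
    qed
    from nn_integral_mono_AE[OF this]
    have "(\<integral>\<^sup>+x. ennreal (step_norm \<kappa> I d (w((a, 0) := x)) powr s) \<partial>N) \<le> ennreal (\<kappa> powr s)
        * ((\<integral>\<^sup>+x. ennreal (\<bar>x - r\<bar> powr (2 * s)) \<partial>N) + (\<integral>\<^sup>+x. ennreal (\<bar>x - (- r)\<bar> powr (2 * s)) \<partial>N))"
      by (subst (asm) nn_integral_cmult, simp, subst (asm) nn_integral_add) simp_all
    also have "\<dots> \<le> ennreal (\<kappa> powr s) * (K + K)"
      by (intro mult_left_mono add_mono K) simp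
    finally show ?thesis .
  qed
  moreover have "ennreal (\<kappa> powr s) * (K + K) < \<infinity>"
    using K_finite by (simp add: ennreal_mult_less_top)
  ultimately show ?thesis by blast
qed

lemma integrable_step_norm_powr_neg:
  assumes d: "d > 0" and I: "finite I" "I \<noteq> {}" and \<kappa>: "\<kappa> > 0" and s: "- (1/2) < s" "s \<le> 0"
  shows "integrable P (\<lambda>w. step_norm \<kappa> I d w powr s)"
proof (intro integrableI_bounded)
  obtain a where a: "a \<in> I" using I by auto
  obtain K where K_finite: "K < \<infinity>"
    and K: "\<And>w. (\<integral>\<^sup>+x. ennreal (step_norm \<kappa> I d (w((a, 0) := x)) powr s) \<partial>N) \<le> K"
    using ex_nn_integral_step_norm_fun_upd_bound[OF d I(1) a \<kappa> s] by blast
  have "(\<integral>\<^sup>+w. ennreal (norm (step_norm \<kappa> I d w powr s)) \<partial>P)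
      = (\<integral>\<^sup>+w. \<integral>\<^sup>+x. ennreal (step_norm \<kappa> I d (w((a, 0) := x)) powr s) \<partial>N \<partial>P)"
    by (subst data.nn_integral_PiM_fun_upd[of _ "(a, 0)"]) simp_all
  also have "\<dots> \<le> (\<integral>\<^sup>+w. K \<partial>P)"
    by (intro nn_integral_mono K)
  also have "\<dots> = K"
    by (simp add: data.emeasure_space_1[simplified])
  also note K_finite
  finally show "(\<integral>\<^sup>+w. ennreal (norm (step_norm \<kappa> I d w powr s)) \<partial>P) < \<infinity>" .
qed measurable

lemma integrable_step_norm_powr:
  assumes "d > 0" "finite I" "I \<noteq> {}" "\<kappa> > 0" "s > - (1/2)"
  shows "integrable P (\<lambda>w. step_norm \<kappa> I d w powr s)"
  using assms integrable_step_norm_powr_pos integrable_step_norm_powr_neg by (cases "s > 0") auto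

definition step_moment :: "real \<Rightarrow> nat set \<Rightarrow> nat \<Rightarrow> real \<Rightarrow> real" where
  "step_moment \<kappa> I d s = data.expectation (\<lambda>w. step_norm \<kappa> I d w powr s)"

lemma nn_integral_step_norm_powr:
  assumes "d > 0" "finite I" "I \<noteq> {}" "\<kappa> > 0" "s > - (1/2)"
  shows "(\<integral>\<^sup>+w. ennreal (step_norm \<kappa> I d w powr s) \<partial>P) = ennreal (step_moment \<kappa> I d s)"
  unfolding step_moment_def using integrable_step_norm_powr[OF assms] by (intro nn_integral_eq_integral) auto

lemma step_moment_card:
  assumes "finite I" "finite I'" "card I = card I'"
  shows "step_moment \<kappa> I d s = step_moment \<kappa> I' d s"
  using integral_distr[of "step_norm \<kappa> I d" P borel "\<lambda>r. r powr s"]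
    integral_distr[of "step_norm \<kappa> I' d" P borel "\<lambda>r. r powr s"] distr_step_norm_card[OF assms]
  by (simp add: step_moment_def)

end

section \<open>The functions h and \<open>\<rho>\<close>\<close>

lemma Pimat_carrier [simp]: "Pimat \<eta> b d w k \<in> carrier_mat d d"
  by (induction k) (auto simp: Mmat_def Hmat_def)

lemma Mmat_mult_vec:
  "Mmat \<eta> b d w (Suc k) *\<^sub>v vec d u = vec d (sgd_step (\<eta> / real b) {b * k + 1 .. b * Suc k} d w u)"
proof (rule eq_vecI)
  fix p assume "p < dim_vec (vec d (sgd_step (\<eta> / real b) {b * k + 1 .. b * Suc k} d w u))"
  then have p: "p < d" by simp
  let ?I = "{b * k + 1 .. b * Suc k}" and ?\<kappa> = "\<eta> / real b"
  have "(Mmat \<eta> b d w (Suc k) *\<^sub>v vec d u) $ p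
      = (\<Sum>q<d. ((if p = q then 1 else 0) - ?\<kappa> * (\<Sum>i\<in>?I. w (i, p) * w (i, q))) * u q)"
    using p by (auto simp: Mmat_def Hmat_def avec_def scalar_prod_def lessThan_atLeast0 intro!: sum.cong)
  also have "\<dots> = (\<Sum>q<d. if p = q then u q else 0) - ?\<kappa> * (\<Sum>q<d. \<Sum>i\<in>?I. w (i, p) * (w (i, q) * u q))"
    unfolding sum_distrib_left sum_subtractf[symmetric]
    by (intro sum.cong) (auto simp: left_diff_distrib sum_distrib_left sum_distrib_right mult.assoc)
  also have "(\<Sum>q<d. if p = q then u q else 0) = u p"
    using p by simp
  also have "(\<Sum>q<d. \<Sum>i\<in>?I. w (i, p) * (w (i, q) * u q)) = (\<Sum>i\<in>?I. w (i, p) * (\<Sum>q<d. w (i, q) * u q))"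
    by (subst sum.swap) (simp add: sum_distrib_left)
  finally show "(Mmat \<eta> b d w (Suc k) *\<^sub>v vec d u) $ p = vec d (sgd_step ?\<kappa> ?I d w u) $ p"
    using p by (simp add: sgd_step_def)
qed (simp add: Mmat_def Hmat_def)

lemma Pimat_mult_vec:
  "Pimat \<eta> b d w k *\<^sub>v vec d u = vec d (sgd_iter (\<eta> / real b) b d w k u)"
proof (induction k)
  case (Suc k)
  have "Mmat \<eta> b d w (Suc k) \<in> carrier_mat d d" by (auto simp: Mmat_def Hmat_def)
  then show ?case
    by (simp add: assoc_mult_mat_vec[OF _ Pimat_carrier] Suc.IH del: mult_Suc_right)
       (simp add: Mmat_mult_vec del: mult_Suc_right)
qed simp

lemma vnorm_Pimat_mult_vec:
  "vnorm (Pimat \<eta> b d w k *\<^sub>v vec d u) = l2norm d (sgd_iter (\<eta> / real b) b d w k u)"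
  by (simp add: Pimat_mult_vec vnorm_vec)

lemma unit_vec_eq_basis_fun: "unit_vec d j = vec d (basis_fun j)"
  by (auto simp: unit_vec_def basis_fun_def)

lemma spec_norm_Pimat_ge:
  assumes "j < d"
  shows "l2norm d (sgd_iter (\<eta> / real b) b d w k (basis_fun j)) \<le> spec_norm d (Pimat \<eta> b d w k)"
  using vnorm_mult_mat_vec_le_spec_norm[of "Pimat \<eta> b d w k" d "unit_vec d j"] assms
  by (simp add: vnorm_unit_vec) (simp add: unit_vec_eq_basis_fun vnorm_Pimat_mult_vec)

lemma spec_norm_Pimat_le:
  assumes "d > 0"
  shows "spec_norm d (Pimat \<eta> b d w k) \<le> (\<Sum>j<d. l2norm d (sgd_iter (\<eta> / real b) b d w k (basis_fun j)))"
proof -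
  let ?X = "\<lambda>j. l2norm d (sgd_iter (\<eta> / real b) b d w k (basis_fun j))"
  have "(frob_norm d (Pimat \<eta> b d w k))\<^sup>2 = (L2_set ?X {..<d})\<^sup>2"
    by (simp add: frob_norm_power2_columns[OF Pimat_carrier] unit_vec_eq_basis_fun vnorm_Pimat_mult_vec
        L2_set_def sum_nonneg)
  then have "frob_norm d (Pimat \<eta> b d w k) = L2_set ?X {..<d}"
    by (simp add: power2_eq_iff_nonneg)
  also have "\<dots> \<le> (\<Sum>j<d. ?X j)"
    by (rule L2_set_le_sum) simp
  finally show ?thesis
    using spec_norm_le_frob_norm[OF Pimat_carrier assms, of \<eta> b w k] by linarith
qed

lemma sum_powr_le:
  fixes f :: "'a \<Rightarrow> real"
  assumes J: "finite J" and f: "\<And>j. j \<in> J \<Longrightarrow> f j \<ge> 0" and s: "s > 0"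
  shows "(\<Sum>j\<in>J. f j) powr s \<le> real (card J) powr s * (\<Sum>j\<in>J. f j powr s)"
proof (cases "J = {}")
  case False
  then have "Max (f ` J) \<in> f ` J"
    using J by (intro Max_in) auto
  then obtain i where i: "i \<in> J" "f i = Max (f ` J)"
    by auto
  then have "f j \<le> f i" if "j \<in> J" for j
    using J that by simp
  then have "(\<Sum>j\<in>J. f j) \<le> real (card J) * f i"
    by (rule sum_bounded_above)
  then have "(\<Sum>j\<in>J. f j) powr s \<le> (real (card J) * f i) powr s"
    using f s by (intro powr_mono2) (auto intro: sum_nonneg)
  also have "\<dots> = real (card J) powr s * f i powr s"
    using f[OF i(1)] by (simp add: powr_mult)
  also have "\<dots> \<le> real (card J) powr s * (\<Sum>j\<in>J. f j powr s)"
    using J i(1) by (intro mult_left_mono member_le_sum) auto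
  finally show ?thesis .
qed simp

lemma LIMSEQ_powr_inverse_of_geometric_bounds:
  fixes a :: "nat \<Rightarrow> real"
  assumes g: "g > 0" and C: "C > 0" and lower: "\<And>k. g ^ k \<le> a k" and upper: "\<And>k. a k \<le> C * g ^ k"
  shows "(\<lambda>k. a k powr (1 / real k)) \<longlonglongrightarrow> g"
proof (rule real_tendsto_sandwich[of "\<lambda>_. g" _ _ "\<lambda>k. C powr (1 / real k) * g"])
  have root_power: "(g ^ k) powr (1 / real k) = g" if "k > 0" for k
    using g that by (simp add: powr_realpow[symmetric] powr_powr)
  have a_nonneg: "0 \<le> a k" for k using order_trans[OF _ lower[of k]] g by simp
  show "\<forall>\<^sub>F k in sequentially. g \<le> a k powr (1 / real k)"
    using eventually_gt_at_top[of 0]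
  proof eventually_elim
    case (elim k)
    have "(g ^ k) powr (1 / real k) \<le> a k powr (1 / real k)"
      using g lower by (intro powr_mono2) auto
    then show ?case using root_power[OF elim] by simp
  qed
  show "\<forall>\<^sub>F k in sequentially. a k powr (1 / real k) \<le> C powr (1 / real k) * g"
    using eventually_gt_at_top[of 0]
  proof eventually_elim
    case (elim k)
    have "a k powr (1 / real k) \<le> (C * g ^ k) powr (1 / real k)"
      using a_nonneg upper by (intro powr_mono2) auto
    then show ?case using root_power[OF elim] by (simp add: powr_mult)
  qed
  have "(\<lambda>k. C powr (1 / real k)) \<longlonglongrightarrow> C powr 0"
    using C by (intro tendsto_powr tendsto_const lim_1_over_n) auto
  from tendsto_mult[OF this tendsto_const[of g]]
  show "(\<lambda>k. C powr (1 / real k) * g) \<longlonglongrightarrow> g" using C by simp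
qed simp

context gaussian_data
begin

lemma measurable_spec_norm_Pimat [measurable]:
  assumes d: "d > 0"
  shows "(\<lambda>w. spec_norm d (Pimat \<eta> b d w k)) \<in> borel_measurable P"
  unfolding borel_measurable_iff_greater
proof
  fix c :: real
  let ?X = "\<lambda>u w. l2norm d (sgd_iter (\<eta> / real b) b d w k u)"
  have "vnorm (Pimat \<eta> b d w k *\<^sub>v x) = ?X (($) x) w" if "x \<in> carrier_vec d" for x w
  proof -
    have "vec d (($) x) = x" using that by (intro eq_vecI) auto
    then show ?thesis using vnorm_Pimat_mult_vec[of \<eta> b d w k "($) x"] by simp
  qed
  then have "{w \<in> space P. c < spec_norm d (Pimat \<eta> b d w k)}
      = (\<Union>x\<in>{x \<in> carrier_vec d. vnorm x = 1}. {w. c < ?X (($) x) w})"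
    by (auto simp: less_spec_norm_iff[OF Pimat_carrier d])
  also have "open \<dots>"
    by (intro open_UN ballI open_Collect_less continuous_intros)
  finally show "{w \<in> space P. c < spec_norm d (Pimat \<eta> b d w k)} \<in> sets P"
    unfolding sets_P_eq_borel by (rule borel_open)
qed

end

locale sgd = gaussian_data +
  fixes \<eta> :: real and b d :: nat
  assumes \<eta>_pos: "\<eta> > 0" and b_pos: "b > 0" and d_pos: "d > 0"
begin

abbreviation one_step :: "(nat \<times> nat \<Rightarrow> real) \<Rightarrow> real" where
  "one_step \<equiv> step_norm (\<eta> / real b) {..<b} d"

abbreviation moment :: "real \<Rightarrow> real" where
  "moment \<equiv> step_moment (\<eta> / real b) {..<b} d"

abbreviation col_norm :: "nat \<Rightarrow> nat \<Rightarrow> (nat \<times> nat \<Rightarrow> real) \<Rightarrow> real" where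
  "col_norm j k w \<equiv> l2norm d (sgd_iter (\<eta> / real b) b d w k (basis_fun j))"

abbreviation prod_norm :: "nat \<Rightarrow> (nat \<times> nat \<Rightarrow> real) \<Rightarrow> real" where
  "prod_norm k w \<equiv> spec_norm d (Pimat \<eta> b d w k)"

abbreviation lyapunov_ratio :: "nat \<Rightarrow> (nat \<times> nat \<Rightarrow> real) \<Rightarrow> real" where
  "lyapunov_ratio k w \<equiv> ln (lambda_max (transpose_mat (Pimat \<eta> b d w k) * Pimat \<eta> b d w k)) / (2 * real k)"

lemma AE_one_step_pos: "AE w in P. one_step w > 0"
  using \<eta>_pos b_pos d_pos by (intro AE_step_norm_pos) auto

lemma integrable_one_step_powr: "s > - (1/2) \<Longrightarrow> integrable P (\<lambda>w. one_step w powr s)"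
  using \<eta>_pos b_pos d_pos by (intro integrable_step_norm_powr) auto

lemma AE_exp_ln_one_step: "AE w in P. exp (s * ln (one_step w)) = one_step w powr s"
  using AE_one_step_pos by eventually_elim (simp add: powr_def)

lemma mgf_ln_one_step: "data.mgf (\<lambda>w. ln (one_step w)) s = moment s"
  unfolding data.mgf_def step_moment_def using AE_exp_ln_one_step by (intro integral_cong_AE) auto

lemma integrable_exp_ln_one_step:
  assumes "s > - (1/2)"
  shows "integrable P (\<lambda>w. exp (s * ln (one_step w)))"
  using integrable_one_step_powr[OF assms] AE_exp_ln_one_step[of s] by (subst integrable_cong_AE) auto

sublocale log_norm: exp_integrable_rv P "\<lambda>w. ln (one_step w)"
proof
  show "integrable P (\<lambda>w. ln (one_step w))"
  proof (rule data.integrable_of_exp)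
    show "integrable P (\<lambda>w. exp (1/4 * ln (one_step w)))" "integrable P (\<lambda>w. exp (- (1/4) * ln (one_step w)))"
      by (intro integrable_exp_ln_one_step, simp)+
  qed simp_all
  show "integrable P (\<lambda>w. exp (s * ln (one_step w)))" if "s > 0" for s
    using that by (intro integrable_exp_ln_one_step) simp
  have "\<not> (AE w in P. one_step w \<le> 1)"
  proof (rule full_support_not_AE_le[OF full_support_P continuous_on_step_norm])
    show "1 < one_step (spike 0 (sqrt (3 * real b / \<eta>)))"
      using \<eta>_pos b_pos d_pos by (simp add: step_norm_spike)
  qed
  moreover have "AE w in P. one_step w \<le> 1" if "AE w in P. ln (one_step w) \<le> 0"
    using that AE_one_step_pos by eventually_elim simp
  ultimately show "\<not> (AE w in P. ln (one_step w) \<le> 0)" by blast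
qed

lemma moment_pos: "s > - (1/2) \<Longrightarrow> moment s > 0"
  using data.mgf_pos[OF integrable_exp_ln_one_step] by (simp add: mgf_ln_one_step)

lemma nn_integral_col_norm_powr:
  assumes "s > - (1/2)" "j < d"
  shows "(\<integral>\<^sup>+w. ennreal (col_norm j k w powr s) \<partial>P) = ennreal (moment s ^ k)"
proof -
  have "(\<integral>\<^sup>+w. ennreal (one_step w powr s) \<partial>P) = ennreal (moment s)"
    using \<eta>_pos b_pos d_pos assms(1) by (intro nn_integral_step_norm_powr) auto
  then show ?thesis
    using moment_pos[OF assms(1)] assms(2) d_pos
    by (simp add: nn_integral_sgd_iter_powr l2norm_basis_fun ennreal_power)
qed

lemma AE_col_norm_pos: "AE w in P. col_norm 0 k w > 0"
proof -
  have "emeasure P {w \<in> space P. col_norm 0 k w > 0} = (\<integral>\<^sup>+w. ennreal (col_norm 0 k w powr 0) \<partial>P)"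
    by (subst nn_integral_indicator[symmetric], measurable)
       (auto intro!: nn_integral_cong simp: indicator_def less_le)
  also have "\<dots> = 1"
    using d_pos data.mgf_0 by (subst nn_integral_col_norm_powr) (auto simp: mgf_ln_one_step[symmetric])
  finally show ?thesis
    by (subst data.AE_iff_emeasure_eq_1) auto
qed

lemma nn_integral_spec_norm_powr_le:
  assumes s: "s > 0"
  shows "(\<integral>\<^sup>+w. ennreal (prod_norm k w powr s) \<partial>P) \<le> ennreal (real d powr s * real d * moment s ^ k)"
proof -
  have "prod_norm k w powr s \<le> real d powr s * (\<Sum>j<d. col_norm j k w powr s)" for w
  proof -
    have "prod_norm k w powr s \<le> (\<Sum>j<d. col_norm j k w) powr s"
      using s d_pos by (intro powr_mono2 spec_norm_Pimat_le spec_norm_nonneg) auto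
    also have "\<dots> \<le> real d powr s * (\<Sum>j<d. col_norm j k w powr s)"
      using sum_powr_le[OF _ _ s, of "{..<d}" "\<lambda>j. col_norm j k w"] by simp
    finally show ?thesis .
  qed
  then have "(\<integral>\<^sup>+w. ennreal (prod_norm k w powr s) \<partial>P)
      \<le> (\<integral>\<^sup>+w. ennreal (real d powr s) * (\<Sum>j<d. ennreal (col_norm j k w powr s)) \<partial>P)"
    by (intro nn_integral_mono) (simp add: sum_ennreal ennreal_mult'[symmetric] sum_nonneg ennreal_leI)
  also have "\<dots> = ennreal (real d powr s) * (\<Sum>j<d. \<integral>\<^sup>+w. ennreal (col_norm j k w powr s) \<partial>P)"
    by (subst nn_integral_cmult, measurable, subst nn_integral_sum) auto
  also have "\<dots> = ennreal (real d powr s * real d * moment s ^ k)"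
    using s moment_pos[of s]
    by (simp add: nn_integral_col_norm_powr ennreal_mult' ennreal_of_nat_eq_real_of_nat mult.assoc)
  finally show ?thesis .
qed

lemma expectation_spec_norm_powr_bounds:
  assumes s: "s > 0"
  shows "moment s ^ k \<le> data.expectation (\<lambda>w. prod_norm k w powr s)"
    and "data.expectation (\<lambda>w. prod_norm k w powr s) \<le> real d powr s * real d * moment s ^ k"
proof -
  note [measurable] = measurable_spec_norm_Pimat[OF d_pos]
  note upper = nn_integral_spec_norm_powr_le[OF s, of k]
  have moment: "moment s > 0" using s by (intro moment_pos) simp
  have "integrable P (\<lambda>w. prod_norm k w powr s)"
    using order_le_less_trans[OF upper ennreal_less_top] by (intro integrableI_bounded) auto
  then have expectation: "(\<integral>\<^sup>+w. ennreal (prod_norm k w powr s) \<partial>P)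
      = ennreal (data.expectation (\<lambda>w. prod_norm k w powr s))"
    by (intro nn_integral_eq_integral) auto
  show "data.expectation (\<lambda>w. prod_norm k w powr s) \<le> real d powr s * real d * moment s ^ k"
    using upper moment unfolding expectation by (simp add: ennreal_le_iff)
  have "ennreal (moment s ^ k) = (\<integral>\<^sup>+w. ennreal (col_norm 0 k w powr s) \<partial>P)"
    using s d_pos by (subst nn_integral_col_norm_powr) auto
  also have "\<dots> \<le> (\<integral>\<^sup>+w. ennreal (prod_norm k w powr s) \<partial>P)"
    using s d_pos by (intro nn_integral_mono ennreal_leI powr_mono2 spec_norm_Pimat_ge) auto
  finally show "moment s ^ k \<le> data.expectation (\<lambda>w. prod_norm k w powr s)"
    unfolding expectation by (simp add: ennreal_le_iff)
qed

lemma hfun_eq_moment: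
  assumes "s > 0"
  shows "hfun \<eta> v b d s = moment s"
  unfolding hfun_def using assms d_pos
  by (intro limI LIMSEQ_powr_inverse_of_geometric_bounds[OF _ _ expectation_spec_norm_powr_bounds] moment_pos) auto

lemma ex_nn_integral_exp_ln_spec_norm_le:
  assumes s: "s \<noteq> 0" "\<bar>s\<bar> \<le> 1/4"
  shows "\<exists>C. \<forall>k. (\<integral>\<^sup>+w. ennreal (exp (s * ln (prod_norm k w))) \<partial>P) \<le> ennreal (C * moment s ^ k)"
proof -
  have AE_pos: "AE w in P. 0 < col_norm 0 k w \<and> col_norm 0 k w \<le> prod_norm k w" for k
    using AE_col_norm_pos[of k] by eventually_elim (use spec_norm_Pimat_ge[OF d_pos] in blast)
  have powr: "(\<integral>\<^sup>+w. ennreal (exp (s * ln (prod_norm k w))) \<partial>P) = (\<integral>\<^sup>+w. ennreal (prod_norm k w powr s) \<partial>P)" for k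
  proof (rule nn_integral_cong_AE)
    show "AE w in P. ennreal (exp (s * ln (prod_norm k w))) = ennreal (prod_norm k w powr s)"
      using AE_pos[of k] by eventually_elim (auto simp: powr_def)
  qed
  show ?thesis
  proof (cases "s > 0")
    case True
    then show ?thesis
      using nn_integral_spec_norm_powr_le[OF True] unfolding powr by blast
  next
    case False
    have "(\<integral>\<^sup>+w. ennreal (prod_norm k w powr s) \<partial>P) \<le> (\<integral>\<^sup>+w. ennreal (col_norm 0 k w powr s) \<partial>P)" for k
    proof (rule nn_integral_mono_AE)
      show "AE w in P. ennreal (prod_norm k w powr s) \<le> ennreal (col_norm 0 k w powr s)"
        using AE_pos[of k] by eventually_elim (use False in \<open>auto intro!: ennreal_leI powr_mono2'\<close>)
    qed
    then have "(\<integral>\<^sup>+w. ennreal (prod_norm k w powr s) \<partial>P) \<le> ennreal (1 * moment s ^ k)" for k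
      using s d_pos by (simp add: nn_integral_col_norm_powr)
    then show ?thesis unfolding powr by blast
  qed
qed

lemma AE_LIMSEQ_lyapunov_ratio:
  "AE w in P. (\<lambda>k. lyapunov_ratio k w) \<longlonglongrightarrow> data.expectation (\<lambda>w. ln (one_step w))"
proof -
  have "lyapunov_ratio k w = ln (prod_norm k w) / real k" for k w
    using spec_norm_nonneg[OF Pimat_carrier d_pos, of \<eta> b w k]
    by (cases "prod_norm k w = 0") (simp_all add: lambda_max_gram_mat[OF Pimat_carrier d_pos] ln_realpow)
  moreover have "AE w in P. (\<lambda>k. ln (prod_norm k w) / real k) \<longlonglongrightarrow> data.expectation (\<lambda>w. ln (one_step w))"
  proof (rule data.AE_LIMSEQ_rate[OF log_norm.integrable_Y, of "1/4"])
    show "integrable P (\<lambda>w. exp (1/4 * ln (one_step w)))" "integrable P (\<lambda>w. exp (- (1/4) * ln (one_step w)))"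
      by (intro integrable_exp_ln_one_step, simp)+
    show "(\<lambda>w. ln (prod_norm k w)) \<in> borel_measurable P" for k
      using measurable_spec_norm_Pimat[OF d_pos] by measurable
  qed (use ex_nn_integral_exp_ln_spec_norm_le in \<open>auto simp: mgf_ln_one_step\<close>)
  ultimately show ?thesis by simp
qed

lemma rho_eq_expectation_ln: "rho \<eta> v b d = data.expectation (\<lambda>w. ln (one_step w))"
  unfolding rho_def
proof (rule the_equality, rule AE_LIMSEQ_lyapunov_ratio)
  fix r assume "AE w in P. (\<lambda>k. lyapunov_ratio k w) \<longlonglongrightarrow> r"
  with AE_LIMSEQ_lyapunov_ratio have "AE w in P. r = data.expectation (\<lambda>w. ln (one_step w))"
    by eventually_elim (rule LIMSEQ_unique)
  then show "r = data.expectation (\<lambda>w. ln (one_step w))" by (simp add: data.AE_const)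
qed

end

locale stable_sgd = sgd +
  assumes rho_neg: "rho \<eta> v b d < 0"
begin

lemma tail_index_pos: "tail_index \<eta> v b d > 0"
  and step_moment_tail_index: "moment (tail_index \<eta> v b d) = 1"
proof -
  have ex1: "\<exists>!\<alpha>. \<alpha> > 0 \<and> moment \<alpha> = 1"
    using log_norm.ex1_mgf_eq_1 rho_neg by (simp add: rho_eq_expectation_ln mgf_ln_one_step)
  have "tail_index \<eta> v b d = (THE \<alpha>. \<alpha> > 0 \<and> moment \<alpha> = 1)"
    unfolding tail_index_def by (rule arg_cong[where f=The]) (auto simp: hfun_eq_moment fun_eq_iff)
  then show "tail_index \<eta> v b d > 0" "moment (tail_index \<eta> v b d) = 1"
    using theI'[OF ex1] by simp_all
qed

lemma less_tail_index:
  assumes "s > 0" "moment s < 1"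
  shows "s < tail_index \<eta> v b d"
  using log_norm.mgf_less_1[of "tail_index \<eta> v b d" s] tail_index_pos step_moment_tail_index assms
  by (cases s "tail_index \<eta> v b d" rule: linorder_cases) (auto simp: mgf_ln_one_step)

lemma tail_index_less:
  assumes "s > 0" "moment s > 1"
  shows "tail_index \<eta> v b d < s"
  using log_norm.mgf_less_1[of s "tail_index \<eta> v b d"] step_moment_tail_index assms
  by (cases s "tail_index \<eta> v b d" rule: linorder_cases) (auto simp: mgf_ln_one_step)

end

lemma admissible_iff_stable_sgd: "admissible \<eta> v b d \<longleftrightarrow> stable_sgd v \<eta> b d"
  by (auto simp: admissible_def stable_sgd_def stable_sgd_axioms_def sgd_def sgd_axioms_def gaussian_data_def)

section \<open>Monotonicity of the tail-index\<close>

lemma convex_on_powr: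
  fixes p :: real
  assumes p: "p \<ge> 1"
  shows "convex_on {0..} (\<lambda>x. x powr p)"
proof (rule convex_on_linorderI)
  fix t x y :: real assume t: "0 < t" "t < 1" and xy: "x \<in> {0..}" "y \<in> {0..}" "x < y"
  show "((1 - t) *\<^sub>R x + t *\<^sub>R y) powr p \<le> (1 - t) * x powr p + t * y powr p"
  proof (cases "x = 0")
    case True
    have "t powr p \<le> t powr 1" using t p by (intro powr_mono') auto
    then have "(t * y) powr p \<le> t * y powr p"
      using t xy by (simp add: powr_mult mult_right_mono)
    then show ?thesis using True by simp
  next
    case False
    then show ?thesis
      using convex_onD[OF powr_convex[OF p], of t x y] t xy by auto
  qed
qed simp

lemma step_norm_mono_dim:
  assumes d: "0 < d1" "d1 \<le> d2"
  shows "step_norm \<kappa> I d1 w \<le> step_norm \<kappa> I d2 w"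
  using d unfolding step_norm_def L2_set_def
  by (intro real_sqrt_le_mono) (auto simp: sgd_step_basis_fun intro!: sum_mono2)

lemma step_norm_ones_less_dim:
  assumes d: "0 < d1" "d1 < d2" and I: "finite I" "I \<noteq> {}" and \<kappa>: "\<kappa> \<noteq> 0"
  shows "step_norm \<kappa> I d1 (\<lambda>_. 1) < step_norm \<kappa> I d2 (\<lambda>_. 1)"
proof -
  let ?u = "\<lambda>p. basis_fun 0 p - \<kappa> * (\<Sum>i\<in>I. 1 * 1)"
  have "?u d1 \<noteq> 0" using d I \<kappa> by (simp add: basis_fun_def)
  then have "(\<Sum>p<d1. (?u p)\<^sup>2) < (\<Sum>p<d2. (?u p)\<^sup>2)"
    using d by (intro sum_strict_mono2[of "{..<d2}" "{..<d1}" d1]) auto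
  then show ?thesis
    using d unfolding step_norm_def L2_set_def by (simp add: sgd_step_basis_fun)
qed

lemma step_norm_convex_stepsize:
  assumes d: "d > 0" and t: "0 \<le> t" "t \<le> 1"
  shows "step_norm (t * \<kappa>) I d w \<le> t * step_norm \<kappa> I d w + (1 - t)"
proof -
  have "sgd_step (t * \<kappa>) I d w (basis_fun 0)
      = (\<lambda>p. t * sgd_step \<kappa> I d w (basis_fun 0) p + (1 - t) * basis_fun 0 p)"
    using d by (simp add: sgd_step_basis_fun fun_eq_iff algebra_simps)
  then show ?thesis
    using L2_set_triangle_ineq[of "\<lambda>p. t * sgd_step \<kappa> I d w (basis_fun 0) p"
        "\<lambda>p. (1 - t) * basis_fun 0 p" "{..<d}"] d t
    by (simp add: step_norm_def L2_set_cmult l2norm_basis_fun)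
qed

lemma step_norm_powr_convex_stepsize:
  assumes d: "d > 0" and t: "0 \<le> t" "t \<le> 1" and s: "s \<ge> 1"
  shows "step_norm (t * \<kappa>) I d w powr s \<le> t * step_norm \<kappa> I d w powr s + (1 - t)"
proof -
  have "step_norm (t * \<kappa>) I d w powr s \<le> (t * step_norm \<kappa> I d w + (1 - t)) powr s"
    using step_norm_convex_stepsize[OF d t] s by (intro powr_mono2) auto
  also have "\<dots> \<le> t * step_norm \<kappa> I d w powr s + (1 - t)"
    using convex_onD[OF convex_on_powr[OF s], of t 1 "step_norm \<kappa> I d w"] t by (simp add: add.commute)
  finally show ?thesis .
qed

text \<open>The step over the batch J is the mean of the steps over its leave-one-out batches.\<close>

lemma step_norm_leave_one_out_le:
  assumes d: "d > 0" and J: "finite J" "card J = Suc b" and b: "b > 0"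
  shows "step_norm (\<eta> / real (Suc b)) J d w \<le> (\<Sum>j\<in>J. 1 / real (Suc b) * step_norm (\<eta> / real b) (J - {j}) d w)"
proof -
  let ?n = "real (Suc b)"
  let ?u = "\<lambda>j. sgd_step (\<eta> / real b) (J - {j}) d w (basis_fun 0)"
  have "sgd_step (\<eta> / ?n) J d w (basis_fun 0) = (\<lambda>p. 1 / ?n * (\<Sum>j\<in>J. ?u j p))"
  proof
    fix p
    define y where "y i = w (i, 0) * w (i, p)" for i
    have "(\<Sum>j\<in>J. \<Sum>i\<in>J - {j}. y i) = (\<Sum>j\<in>J. (\<Sum>i\<in>J. y i) - y j)"
      using J by (intro sum.cong) (auto simp: sum_diff1)
    also have "\<dots> = real b * (\<Sum>i\<in>J. y i)"
      using J by (simp add: sum_subtractf algebra_simps)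
    finally have "(\<Sum>j\<in>J. ?u j p) = ?n * basis_fun 0 p - \<eta> * (\<Sum>i\<in>J. y i)"
      using J d b by (simp add: sgd_step_basis_fun sum_subtractf sum_divide_distrib[symmetric]
          sum_distrib_left[symmetric] y_def)
    then show "sgd_step (\<eta> / ?n) J d w (basis_fun 0) p = 1 / ?n * (\<Sum>j\<in>J. ?u j p)"
      using d by (simp add: sgd_step_basis_fun y_def field_simps)
  qed
  then have "step_norm (\<eta> / ?n) J d w = 1 / ?n * l2norm d (\<lambda>p. \<Sum>j\<in>J. ?u j p)"
    by (simp only: step_norm_def L2_set_cmult) simp
  also have "\<dots> \<le> 1 / ?n * (\<Sum>j\<in>J. step_norm (\<eta> / real b) (J - {j}) d w)"
    unfolding step_norm_def by (intro mult_left_mono L2_set_sum_le) simp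
  finally show ?thesis by (simp only: sum_distrib_left)
qed

lemma step_norm_powr_leave_one_out_le:
  assumes d: "d > 0" and J: "finite J" "card J = Suc b" and b: "b > 0" and s: "s \<ge> 1"
  shows "step_norm (\<eta> / real (Suc b)) J d w powr s
    \<le> (\<Sum>j\<in>J. 1 / real (Suc b) * step_norm (\<eta> / real b) (J - {j}) d w powr s)"
proof -
  let ?n = "real (Suc b)"
  let ?R = "\<lambda>j. step_norm (\<eta> / real b) (J - {j}) d w"
  have ne: "J \<noteq> {}" using J by auto
  have "step_norm (\<eta> / ?n) J d w powr s \<le> (\<Sum>j\<in>J. 1 / ?n * ?R j) powr s"
    using step_norm_leave_one_out_le[OF d J b] s by (intro powr_mono2) auto
  also have "\<dots> \<le> (\<Sum>j\<in>J. 1 / ?n * ?R j powr s)"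
    using convex_on_sum[OF J(1) ne convex_on_powr[OF s], of "\<lambda>_. 1 / ?n" ?R] J(2) by simp
  finally show ?thesis .
qed

lemma step_norm_powr_leave_one_out_less_spike:
  assumes d: "d > 0" and J: "finite J" "card J = Suc b" "a \<in> J" and b: "b > 0" and \<eta>: "\<eta> > 0" and s: "s > 0"
  defines "w \<equiv> spike a (sqrt (2 * real b / \<eta>))"
  shows "step_norm (\<eta> / real (Suc b)) J d w powr s
    < (\<Sum>j\<in>J. 1 / real (Suc b) * step_norm (\<eta> / real b) (J - {j}) d w powr s)"
proof -
  have "step_norm (\<eta> / real (Suc b)) J d w = \<bar>1 - 2 * real b / real (Suc b)\<bar>"
    using d J \<eta> by (simp add: w_def step_norm_spike)
  also have "\<dots> < 1" using b by (simp add: abs_less_iff field_simps)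
  finally have "step_norm (\<eta> / real (Suc b)) J d w powr s < 1"
    using s powr_less_mono2[of s "step_norm (\<eta> / real (Suc b)) J d w" 1] by simp
  moreover have "step_norm (\<eta> / real b) (J - {j}) d w = 1" for j
    using d J(1) b \<eta> by (auto simp: w_def step_norm_spike)
  ultimately show ?thesis using J(2) by simp
qed

context gaussian_data
begin

lemma continuous_on_step_norm_powr [continuous_intros]:
  "s > 0 \<Longrightarrow> continuous_on UNIV (\<lambda>w. step_norm \<kappa> I d w powr s)"
  by (intro continuous_on_powr' continuous_intros) auto

lemma step_moment_less_dim:
  assumes d: "0 < d1" "d1 < d2" and I: "finite I" "I \<noteq> {}" and \<kappa>: "\<kappa> > 0" and s: "s > 0"
  shows "step_moment \<kappa> I d1 s < step_moment \<kappa> I d2 s"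
  unfolding step_moment_def
proof (rule integral_less_full_support[OF data.finite_measure full_support_P])
  show "AE w in P. step_norm \<kappa> I d1 w powr s \<le> step_norm \<kappa> I d2 w powr s"
    using d s by (intro AE_I2 powr_mono2 step_norm_mono_dim) auto
  show "step_norm \<kappa> I d1 (\<lambda>_. 1) powr s < step_norm \<kappa> I d2 (\<lambda>_. 1) powr s"
    using d I \<kappa> s by (intro powr_less_mono2 step_norm_ones_less_dim) auto
qed (use d I \<kappa> s in \<open>auto intro!: integrable_step_norm_powr continuous_intros\<close>)

lemma step_moment_less_stepsize:
  assumes d: "d > 0" and I: "finite I" "I \<noteq> {}" and \<kappa>: "0 < \<kappa>1" "\<kappa>1 < \<kappa>2" and s: "s \<ge> 1"
  defines "t \<equiv> \<kappa>1 / \<kappa>2"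
  shows "step_moment \<kappa>1 I d s < t * step_moment \<kappa>2 I d s + (1 - t)"
proof -
  have t: "0 < t" "t < 1" "\<kappa>1 = t * \<kappa>2" using \<kappa> by (auto simp: t_def)
  obtain a where a: "a \<in> I" using I by auto
  have int: "integrable P (\<lambda>w. step_norm \<kappa> I d w powr s)" if "\<kappa> > 0" for \<kappa>
    using d I s that by (intro integrable_step_norm_powr) auto
  have "step_moment \<kappa>1 I d s < data.expectation (\<lambda>w. t * step_norm \<kappa>2 I d w powr s + (1 - t))"
    unfolding step_moment_def
  proof (rule integral_less_full_support[OF data.finite_measure full_support_P])
    show "AE w in P. step_norm \<kappa>1 I d w powr s \<le> t * step_norm \<kappa>2 I d w powr s + (1 - t)"
      unfolding t(3) using t(1,2) by (intro AE_I2 step_norm_powr_convex_stepsize d s) auto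
    have "step_norm \<kappa>1 I d (spike a (sqrt (2 / \<kappa>2))) = \<bar>1 - 2 * t\<bar>"
      using a d I \<kappa> by (simp add: step_norm_spike t_def mult.commute)
    then have "step_norm \<kappa>1 I d (spike a (sqrt (2 / \<kappa>2))) powr s < 1"
      using t s powr_less_mono2[of s "\<bar>1 - 2 * t\<bar>" 1] by simp
    moreover have "step_norm \<kappa>2 I d (spike a (sqrt (2 / \<kappa>2))) = 1"
      using a d I \<kappa> by (simp add: step_norm_spike)
    ultimately show "step_norm \<kappa>1 I d (spike a (sqrt (2 / \<kappa>2))) powr s
        < t * step_norm \<kappa>2 I d (spike a (sqrt (2 / \<kappa>2))) powr s + (1 - t)"
      by simp
  qed (use int \<kappa> s in \<open>auto intro!: continuous_intros\<close>)
  also have "\<dots> = t * step_moment \<kappa>2 I d s + (1 - t)"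
    using int[of \<kappa>2] \<kappa> data.P.prob_space by (simp add: step_moment_def)
  finally show ?thesis .
qed

lemma step_moment_Suc_batch_less:
  assumes d: "d > 0" and b: "b > 0" and \<eta>: "\<eta> > 0" and s: "s \<ge> 1"
  shows "step_moment (\<eta> / real (Suc b)) {..<Suc b} d s < step_moment (\<eta> / real b) {..<b} d s"
proof -
  define J where "J = {..<Suc b}"
  define n where "n = real (Suc b)"
  define \<kappa> where "\<kappa> = \<eta> / real b"
  let ?R = "\<lambda>j. step_norm \<kappa> (J - {j}) d"
  have J: "finite J" "card J = Suc b" "J \<noteq> {}" by (auto simp: J_def)
  have n: "n > 0" "real (card J) = n" by (simp_all add: n_def J)
  have \<kappa>: "\<kappa> > 0" using \<eta> b by (simp add: \<kappa>_def)
  have card: "card (J - {j}) = b" if "j \<in> J" for j using J that by simp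
  have int: "integrable P (\<lambda>w. ?R j w powr s)" if "j \<in> J" for j
    using d b J \<kappa> s card[OF that] by (intro integrable_step_norm_powr) (auto simp: card_gt_0_iff)
  have "step_moment (\<eta> / n) J d s < data.expectation (\<lambda>w. \<Sum>j\<in>J. 1 / n * ?R j w powr s)"
    unfolding step_moment_def
  proof (rule integral_less_full_support[OF data.finite_measure full_support_P])
    show "AE w in P. step_norm (\<eta> / n) J d w powr s \<le> (\<Sum>j\<in>J. 1 / n * ?R j w powr s)"
      unfolding n_def \<kappa>_def by (intro AE_I2 step_norm_powr_leave_one_out_le d J b s)
    show "step_norm (\<eta> / n) J d (spike 0 (sqrt (2 * real b / \<eta>))) powr s
        < (\<Sum>j\<in>J. 1 / n * ?R j (spike 0 (sqrt (2 * real b / \<eta>))) powr s)"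
      unfolding n_def \<kappa>_def using s
      by (intro step_norm_powr_leave_one_out_less_spike d J b \<eta>) (auto simp: J_def)
    show "integrable P (\<lambda>w. step_norm (\<eta> / n) J d w powr s)"
      using d J n \<eta> s by (intro integrable_step_norm_powr) auto
  qed (use int s n in \<open>auto intro!: continuous_intros\<close>)
  also have "\<dots> = (\<Sum>j\<in>J. 1 / n * step_moment \<kappa> (J - {j}) d s)"
    using int by (simp add: step_moment_def)
  also have "\<dots> = (\<Sum>j\<in>J. 1 / n * step_moment \<kappa> {..<b} d s)"
    using J card by (intro sum.cong arg_cong2[where f = "(*)"] step_moment_card) auto
  also have "\<dots> = step_moment \<kappa> {..<b} d s" using n by simp
  finally show ?thesis by (simp add: J_def n_def \<kappa>_def)
qed

lemma step_moment_less_batch: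
  assumes d: "d > 0" and b: "0 < b1" "b1 < b2" and \<eta>: "\<eta> > 0" and s: "s \<ge> 1"
  shows "step_moment (\<eta> / real b2) {..<b2} d s < step_moment (\<eta> / real b1) {..<b1} d s"
  using b(2,1)
proof (induction rule: less_Suc_induct)
  case (1 b)
  then show ?case using step_moment_Suc_batch_less[OF d _ \<eta> s] by simp
next
  case (2 b1 b b2)
  then show ?case by fastforce
qed

lemma N_eq_distr_scale: "N = distr (density lborel (normal_density 0 1)) borel (\<lambda>x. sqrt v * x)"
proof -
  interpret std: prob_space "density lborel (normal_density 0 1)"
    by (rule prob_space_normal_density) simp
  have "distributed (density lborel (normal_density 0 1)) lborel (\<lambda>x. x) (normal_density 0 1)"
    by (simp add: distributed_def distr_id2)
  from std.normal_density_affine[OF this, of "sqrt v" 0] v_pos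
  show ?thesis
    by (simp add: distributed_def distr_cong[OF refl sets_lborel refl])
qed

lemma P_eq_distr_scale: "P = distr (data_space 1) P (\<lambda>w p. sqrt v * w p)"
proof -
  interpret std: gaussian_data 1 by unfold_locales simp
  have "P = PiM UNIV (\<lambda>_. distr std.N borel (\<lambda>x. sqrt v * x))"
    by (simp add: PiM_N[symmetric] N_eq_distr_scale[symmetric])
  also have "\<dots> = distr std.P (PiM UNIV (\<lambda>_. borel)) (\<lambda>w. \<lambda>p\<in>UNIV. sqrt v * w p)"
    by (rule std.data.distr_PiM_map[symmetric]) simp
  also have "\<dots> = distr std.P P (\<lambda>w p. sqrt v * w p)"
    by (intro distr_cong) (simp_all add: sets_P restrict_def)
  finally show ?thesis .
qed

lemma step_norm_scale: "step_norm \<kappa> I d (\<lambda>p. sqrt v * w p) = step_norm (\<kappa> * v) I d w"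
proof -
  have "sqrt v * x * (sqrt v * y) = v * (x * y)" for x y
    using v_pos by (metis mult.assoc mult.left_commute real_sqrt_mult_self abs_of_pos)
  then have "sgd_step \<kappa> I d (\<lambda>p. sqrt v * w p) u = sgd_step (\<kappa> * v) I d w u" for u
    by (simp only: sgd_step_def sum_distrib_left[symmetric] mult.assoc)
  then show ?thesis
    by (simp only: step_norm_def)
qed

lemma step_moment_scale: "step_moment \<kappa> I d s = gaussian_data.step_moment 1 (\<kappa> * v) I d s"
proof -
  interpret std: gaussian_data 1 by unfold_locales simp
  have scale: "(\<lambda>w p. sqrt v * w p) \<in> std.P \<rightarrow>\<^sub>M P"
    by (rule measurable_into_P) simp
  have "step_moment \<kappa> I d s = (\<integral>w. step_norm \<kappa> I d w powr s \<partial>distr std.P P (\<lambda>w p. sqrt v * w p))"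
    unfolding step_moment_def by (simp only: P_eq_distr_scale[symmetric])
  also have "\<dots> = std.step_moment (\<kappa> * v) I d s"
    unfolding std.step_moment_def step_norm_scale[symmetric] by (rule integral_distr[OF scale]) simp
  finally show ?thesis .
qed

end

lemma tail_index_less_batch:
  assumes "admissible \<eta> v b1 d" "admissible \<eta> v b2 d" and less: "b1 < b2" and ge: "tail_index \<eta> v b1 d \<ge> 1"
  shows "tail_index \<eta> v b1 d < tail_index \<eta> v b2 d"
proof -
  interpret s1: stable_sgd v \<eta> b1 d using assms(1) by (simp add: admissible_iff_stable_sgd)
  interpret s2: stable_sgd v \<eta> b2 d using assms(2) by (simp add: admissible_iff_stable_sgd)
  have "s2.moment (tail_index \<eta> v b1 d) < s1.moment (tail_index \<eta> v b1 d)"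
    using less ge by (intro s1.step_moment_less_batch s1.\<eta>_pos s1.b_pos s1.d_pos)
  then show ?thesis
    using s1.tail_index_pos s1.step_moment_tail_index by (intro s2.less_tail_index) simp_all
qed

lemma tail_index_less_stepsize_variance:
  assumes "admissible \<eta>1 v1 b d" "admissible \<eta>2 v2 b d" and less: "\<eta>1 * v1 < \<eta>2 * v2"
    and ge: "tail_index \<eta>1 v1 b d \<ge> 1"
  shows "tail_index \<eta>2 v2 b d < tail_index \<eta>1 v1 b d"
proof -
  interpret s1: stable_sgd v1 \<eta>1 b d using assms(1) by (simp add: admissible_iff_stable_sgd)
  interpret s2: stable_sgd v2 \<eta>2 b d using assms(2) by (simp add: admissible_iff_stable_sgd)
  interpret std: gaussian_data 1 by unfold_locales simp
  define \<alpha> where "\<alpha> = tail_index \<eta>1 v1 b d"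
  define \<kappa>1 \<kappa>2 where "\<kappa>1 = \<eta>1 / real b * v1" and "\<kappa>2 = \<eta>2 / real b * v2"
  have \<kappa>: "0 < \<kappa>1" "\<kappa>1 < \<kappa>2"
    using s1.\<eta>_pos s1.v_pos s1.b_pos less by (simp_all add: \<kappa>1_def \<kappa>2_def divide_strict_right_mono)
  have "1 = std.step_moment \<kappa>1 {..<b} d \<alpha>"
    using s1.step_moment_tail_index by (simp add: s1.step_moment_scale \<alpha>_def \<kappa>1_def)
  also have "\<dots> < \<kappa>1 / \<kappa>2 * std.step_moment \<kappa>2 {..<b} d \<alpha> + (1 - \<kappa>1 / \<kappa>2)"
    using s1.d_pos s1.b_pos \<kappa> ge by (intro std.step_moment_less_stepsize) (auto simp: \<alpha>_def)
  also have "std.step_moment \<kappa>2 {..<b} d \<alpha> = s2.moment \<alpha>"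
    by (simp add: s2.step_moment_scale \<kappa>2_def)
  finally have "\<kappa>1 / \<kappa>2 * 1 < \<kappa>1 / \<kappa>2 * s2.moment \<alpha>" by simp
  then have "1 < s2.moment \<alpha>" using \<kappa> by (simp only: mult_less_cancel_left_pos divide_pos_pos)
  then show ?thesis
    using s1.tail_index_pos by (intro s2.tail_index_less) (simp_all add: \<alpha>_def)
qed

lemma tail_index_less_dim:
  assumes "admissible \<eta> v b d1" "admissible \<eta> v b d2" and less: "d1 < d2"
  shows "tail_index \<eta> v b d2 < tail_index \<eta> v b d1"
proof -
  interpret s1: stable_sgd v \<eta> b d1 using assms(1) by (simp add: admissible_iff_stable_sgd)
  interpret s2: stable_sgd v \<eta> b d2 using assms(2) by (simp add: admissible_iff_stable_sgd)
  have "s1.moment (tail_index \<eta> v b d1) < s2.moment (tail_index \<eta> v b d1)"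
    using less s1.\<eta>_pos s1.b_pos s1.d_pos s1.tail_index_pos by (intro s1.step_moment_less_dim) auto
  then show ?thesis
    using s1.tail_index_pos s1.step_moment_tail_index by (intro s2.tail_index_less) simp_all
qed

theorem theorem4:
  shows
   "(\<forall>\<eta> v d b1 b2. admissible \<eta> v b1 d \<and> admissible \<eta> v b2 d \<and> b1 < b2 \<and>
        tail_index \<eta> v b1 d \<ge> 1 \<and> tail_index \<eta> v b2 d \<ge> 1
        \<longrightarrow> tail_index \<eta> v b1 d < tail_index \<eta> v b2 d)
  \<and> (\<forall>\<eta>1 \<eta>2 v b d. admissible \<eta>1 v b d \<and> admissible \<eta>2 v b d \<and> \<eta>1 < \<eta>2 \<and>
        tail_index \<eta>1 v b d \<ge> 1 \<and> tail_index \<eta>2 v b d \<ge> 1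
        \<longrightarrow> tail_index \<eta>2 v b d < tail_index \<eta>1 v b d)
  \<and> (\<forall>\<eta> v1 v2 b d. admissible \<eta> v1 b d \<and> admissible \<eta> v2 b d \<and> v1 < v2 \<and>
        tail_index \<eta> v1 b d \<ge> 1 \<and> tail_index \<eta> v2 b d \<ge> 1
        \<longrightarrow> tail_index \<eta> v2 b d < tail_index \<eta> v1 b d)
  \<and> (\<forall>\<eta> v b d1 d2. admissible \<eta> v b d1 \<and> admissible \<eta> v b d2 \<and> d1 < d2
        \<longrightarrow> tail_index \<eta> v b d2 < tail_index \<eta> v b d1)"
proof (intro conjI allI impI; elim conjE)
  show "tail_index \<eta> v b1 d < tail_index \<eta> v b2 d"
    if "admissible \<eta> v b1 d" "admissible \<eta> v b2 d" "b1 < b2" "1 \<le> tail_index \<eta> v b1 d" for \<eta> v d b1 b2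
    using that by (rule tail_index_less_batch)
  show "tail_index \<eta>2 v b d < tail_index \<eta>1 v b d"
    if "admissible \<eta>1 v b d" "admissible \<eta>2 v b d" "\<eta>1 < \<eta>2" "1 \<le> tail_index \<eta>1 v b d" for \<eta>1 \<eta>2 v b d
    using that by (intro tail_index_less_stepsize_variance) (auto simp: admissible_def)
  show "tail_index \<eta> v2 b d < tail_index \<eta> v1 b d"
    if "admissible \<eta> v1 b d" "admissible \<eta> v2 b d" "v1 < v2" "1 \<le> tail_index \<eta> v1 b d" for \<eta> v1 v2 b d
    using that by (intro tail_index_less_stepsize_variance) (auto simp: admissible_def)
  show "tail_index \<eta> v b d2 < tail_index \<eta> v b d1"
    if "admissible \<eta> v b d1" "admissible \<eta> v b d2" "d1 < d2" for \<eta> v b d1 d2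
    using that by (rule tail_index_less_dim)
qed

end
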